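(* Let $K=K(n,m,\Lambda)$ be a Bedford-McMullen carpet with $n>m\ge2$, and suppose $2\le N\le n-1$, where $N=\max_{0\le j\le m-1}\#I_j$. Write $\alpha:=\frac{\log N}{\log n}$. Let $y\in\pi_2(K)$. If $0<\mathcal{H}^\alpha(K^y)<\infty$ and there is a contracting similitude $h$ of $\mathbb{R}$ with positive contraction ratio such that $h(K^y)\subset K^y$, then the contraction ratio of $h$ is a rational power of $n$.
   Context: Bedford-McMullen carpet: let $n>m\ge 2$ be integers and $\Lambda\subset\{0,\dots,n-1\}\times\{0,\dots,m-1\}$ with $1<\#\Lambda<mn$ (always assumed). Then $K(n,m,\Lambda)=\left\{\left(\sum_{k\ge1} i_k n^{-k},\sum_{k\ge1} j_k m^{-k}\right):(i_k,j_k)\in\Lambda\text{ for all }k\right\}\subset[0,1]^2$. Notation: $I_j:=\{0\le i\le n-1:(i,j)\in\Lambda\}$ for $0\le j\le m-1$; $\pi_2$ is the projection to the $y$-coordinate; $K^y:=\{x\in\mathbb{R}:(x,y)\in K\}$ is the horizontal slice at height $y$; $\mathcal{H}^s$ is $s$-dimensional Hausdorff measure. A contracting similitude of $\mathbb{R}$ with positive contraction ratio $\rho$ is a map $h(x)=\pm\rho x+a$ with $0<\rho<1$, $a\in\mathbb{R}$. *)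

theory Defs
  imports "HOL-Analysis.Analysis"
begin

(* The empty set contributes 0 and, for s = 0, every nonempty set contributes 1;
   powr alone would give 0 powr 0 = 0. *)
definition diam_pow :: "real \<Rightarrow> 'a::metric_space set \<Rightarrow> ennreal" where
  "diam_pow s U = (if U = {} then 0 else if s = 0 then 1 else ennreal (diameter U powr s))"

(* Infimum over countable covers by sets of diameter at most d.  The library's diameter is an
   unspecified real on unbounded sets, so boundedness is required explicitly.  Finite covers are
   included by padding with the empty set. *)
definition hausdorff_premeasure :: "real \<Rightarrow> real \<Rightarrow> 'a::metric_space set \<Rightarrow> ennreal" where
  "hausdorff_premeasure s d A =
     (INF U \<in> {U :: nat \<Rightarrow> 'a set. A \<subseteq> (\<Union>k. U k) \<and> (\<forall>k. bounded (U k) \<and> diameter (U k) \<le> d)}.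
        \<Sum>k. diam_pow s (U k))"

definition hausdorff_measure :: "real \<Rightarrow> 'a::metric_space set \<Rightarrow> ennreal" where
  "hausdorff_measure s A = (SUP d \<in> {0<..}. hausdorff_premeasure s d A)"

(* Digit sequences are indexed from 0 here, so the k-th digit carries the weight n^-(k+1). *)
definition bm_carpet :: "nat \<Rightarrow> nat \<Rightarrow> (nat \<times> nat) set \<Rightarrow> (real \<times> real) set" where
  "bm_carpet n m \<Lambda> =
     {((\<Sum>k. real (i k) / real n ^ Suc k), (\<Sum>k. real (j k) / real m ^ Suc k)) | i j.
        \<forall>k::nat. (i k, j k) \<in> \<Lambda>}"

definition digit_row :: "nat \<Rightarrow> (nat \<times> nat) set \<Rightarrow> nat \<Rightarrow> nat set" where
  "digit_row n \<Lambda> j = {i \<in> {0..n - 1}. (i, j) \<in> \<Lambda>}"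

definition horizontal_slice :: "(real \<times> real) set \<Rightarrow> real \<Rightarrow> real set" where
  "horizontal_slice K y = {x. (x, y) \<in> K}"

definition contracting_similitude :: "real \<Rightarrow> (real \<Rightarrow> real) \<Rightarrow> bool" where
  "contracting_similitude \<rho> h \<longleftrightarrow>
     0 < \<rho> \<and> \<rho> < 1 \<and> (\<exists>a. h = (\<lambda>x. \<rho> * x + a) \<or> h = (\<lambda>x. - \<rho> * x + a))"

end

theory Submission
  imports Defs
begin

text \<open>
Write \<open>F\<close> for the slice and \<open>M U = \<H>\<^sup>\<alpha>(F \<inter> U)\<close> for the mass of an interval \<open>U\<close>. The ratio of \<open>h\<close> is
tied to \<open>n\<close> by two properties of \<open>M\<close>.

The first is a quantization: there is a finite set \<open>S\<close> such that, for all large \<open>l\<close>, every \<open>n\<close>-adic cell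
of level \<open>l\<close> has a mass in \<open>N\<^sup>-\<^sup>l S\<close> (\<open>finitely_many_cell_masses\<close>). Indeed the part of \<open>F\<close> inside such a
cell is a scaled union of slices at heights congruent to \<open>m\<^sup>l y\<close> modulo 1. Either these heights are
eventually 0 and 1 only, or there is a single one, and then the masses of the slices satisfy a recursion
that makes them eventually constant. The second property is that \<open>h F \<subseteq> F\<close> gives
\<open>M (h U) \<ge> \<rho>\<^sup>\<alpha> M U\<close>.

Choose an interval \<open>U\<close> whose density \<open>M U / |U|\<^sup>\<alpha>\<close> is within a factor \<open>1 \<plusminus> \<epsilon>\<close> of the limiting maximal
density at small scales (\<open>near_extremal_interval\<close>). The images of \<open>U\<close> under the iterates of \<open>h\<close> are
shorter, so they cannot be much denser than \<open>U\<close>; but they already contain the scaled mass of \<open>U\<close>. So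
\<open>h\<^sup>k\<close> multiplies the mass of every substantial part of \<open>U\<close> by \<open>\<rho>\<^sup>k\<^sup>\<alpha>\<close>, up to a relative error \<open>O(\<epsilon>)\<close>. Since
\<open>\<alpha> < 1\<close>, there are massless gaps near both ends of \<open>U\<close>, of length at least \<open>\<delta> |U|\<close> with \<open>\<delta>\<close> independent of
\<open>U\<close> and \<open>\<epsilon>\<close> (\<open>massless_gap\<close>). Let \<open>x\<close> be the mass of \<open>U\<close> between the gaps. The image of each gap contains
an \<open>n\<close>-adic point of a level \<open>l\<close> with \<open>n\<^sup>-\<^sup>l\<close> comparable to \<open>\<rho>\<^sup>k |U|\<close>. The mass between these two points is
\<open>\<rho>\<^sup>k\<^sup>\<alpha> x\<close> up to the error, and it is also a sum of boundedly many cell masses. So \<open>(\<rho>\<^sup>k n\<^sup>l)\<^sup>\<alpha> x\<close> is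
approximately an element of a finite set that does not depend on \<open>k\<close> and \<open>\<epsilon>\<close> (\<open>quantized_image_mass\<close>).

By the pigeonhole principle some \<open>\<rho>\<^sup>j n\<^sup>e\<close>, with \<open>j \<ge> 1\<close> bounded independently of \<open>\<epsilon>\<close>, differs from 1 by
\<open>O(\<epsilon>)\<close>. As \<open>\<epsilon>\<close> is arbitrary, \<open>\<rho>\<^sup>j n\<^sup>e = 1\<close> for some such \<open>j\<close> and \<open>e\<close>. If \<open>h\<close> reverses orientation, the
argument applies to \<open>h \<circ> h\<close>.
\<close>

section \<open>Hausdorff measure on the line\<close>

lemma diam_pow_empty [simp]: "diam_pow s {} = 0"
  by (simp add: diam_pow_def)

lemma diam_pow_le:
  assumes "s > 0" "bounded U" "diameter U \<le> d" shows "diam_pow s U \<le> ennreal (d powr s)"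
  using assms by (auto simp: diam_pow_def intro!: ennreal_leI powr_mono2 diameter_ge_0)

lemma hausdorff_premeasure_leI:
  assumes "A \<subseteq> (\<Union>k. U k)" "\<And>k. bounded (U k)" "\<And>k. diameter (U k) \<le> d"
  shows "hausdorff_premeasure s d A \<le> (\<Sum>k. diam_pow s (U k))"
  unfolding hausdorff_premeasure_def by (rule INF_lower) (use assms in auto)

lemma hausdorff_premeasure_greatest:
  assumes "\<And>U. \<lbrakk>A \<subseteq> (\<Union>k. U k); \<And>k. bounded (U k); \<And>k. diameter (U k) \<le> d\<rbrakk> \<Longrightarrow> c \<le> (\<Sum>k. diam_pow s (U k))"
  shows "c \<le> hausdorff_premeasure s d A"
  unfolding hausdorff_premeasure_def by (rule INF_greatest) (use assms in auto)

lemma hausdorff_premeasure_approx: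
  assumes "hausdorff_premeasure s d A < \<infinity>" "e > 0"
  obtains U where "A \<subseteq> (\<Union>k. U k)" "\<And>k. bounded (U k)" "\<And>k. diameter (U k) \<le> d"
    "(\<Sum>k. diam_pow s (U k)) \<le> hausdorff_premeasure s d A + ennreal e"
  using INF_approx_ennreal[OF assms(2) refl, of
      "\<lambda>U. \<Sum>k. diam_pow s (U k)" "{U :: nat \<Rightarrow> 'a set. A \<subseteq> (\<Union>k. U k) \<and> (\<forall>k. bounded (U k) \<and> diameter (U k) \<le> d)}"]
    assms(1) that
  unfolding hausdorff_premeasure_def[symmetric]
  by (fastforce intro: less_imp_le simp: less_top)

lemma hausdorff_premeasure_mono:
  "A \<subseteq> B \<Longrightarrow> hausdorff_premeasure s d A \<le> hausdorff_premeasure s d B"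
  by (rule hausdorff_premeasure_greatest, rule hausdorff_premeasure_leI) auto

lemma hausdorff_premeasure_antimono:
  "d \<le> e \<Longrightarrow> hausdorff_premeasure s e A \<le> hausdorff_premeasure s d A"
  by (rule hausdorff_premeasure_greatest, rule hausdorff_premeasure_leI)
     (auto intro: order_trans)

lemma hausdorff_premeasure_le_measure:
  "d > 0 \<Longrightarrow> hausdorff_premeasure s d A \<le> hausdorff_measure s A"
  unfolding hausdorff_measure_def by (rule SUP_upper) auto

lemma hausdorff_measure_le:
  "(\<And>d. d > 0 \<Longrightarrow> hausdorff_premeasure s d A \<le> c) \<Longrightarrow> hausdorff_measure s A \<le> c"
  unfolding hausdorff_measure_def by (rule SUP_least) auto

lemma hausdorff_measure_mono:
  "A \<subseteq> B \<Longrightarrow> hausdorff_measure s A \<le> hausdorff_measure s B"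
  by (intro hausdorff_measure_le order_trans[OF hausdorff_premeasure_mono hausdorff_premeasure_le_measure])

lemma hausdorff_premeasure_empty:
  assumes "d \<ge> 0" shows "hausdorff_premeasure s d {} = 0"
proof -
  have "hausdorff_premeasure s d ({} :: 'a set) \<le> (\<Sum>k::nat. diam_pow s ({} :: 'a set))"
    by (rule hausdorff_premeasure_leI) (use assms in auto)
  then show ?thesis by simp
qed

lemma hausdorff_measure_empty [simp]: "hausdorff_measure s {} = 0"
  using hausdorff_measure_le[of s "{}" 0] by (simp add: hausdorff_premeasure_empty)

lemma hausdorff_premeasure_Un:
  fixes A B :: "'a::metric_space set"
  assumes "d \<ge> 0"
  shows "hausdorff_premeasure s d (A \<union> B) \<le> hausdorff_premeasure s d A + hausdorff_premeasure s d B"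
proof -
  have main: "hausdorff_premeasure s d (A \<union> B) \<le> (\<Sum>k. diam_pow s (U k)) + (\<Sum>k. diam_pow s (V k))"
    if U: "A \<subseteq> (\<Union>k. U k)" "\<And>k. bounded (U k)" "\<And>k. diameter (U k) \<le> d"
      and V: "B \<subseteq> (\<Union>k. V k)" "\<And>k. bounded (V k)" "\<And>k. diameter (V k) \<le> d"
    for U V :: "nat \<Rightarrow> 'a set"
  proof -
    \<comment> \<open>The two covers are merged into one sequence along the pairing function on \<open>nat\<close>.\<close>
    define W where "W = (\<lambda>(i :: nat, j). if i = 0 then U j else if i = 1 then V j else {})"
    have "hausdorff_premeasure s d (A \<union> B) \<le> (\<Sum>k. diam_pow s (W (prod_decode k)))"
    proof (rule hausdorff_premeasure_leI)
      have "x \<in> (\<Union>k. W (prod_decode k))" if x: "x \<in> A \<union> B" for x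
      proof -
        have "\<exists>p. x \<in> W p"
        proof (cases "x \<in> A")
          case True
          then obtain j where "x \<in> U j" using U(1) by auto
          then show ?thesis by (intro exI[of _ "(0, j)"]) (simp add: W_def)
        next
          case False
          then obtain j where "x \<in> V j" using x V(1) by auto
          then show ?thesis by (intro exI[of _ "(1, j)"]) (simp add: W_def)
        qed
        then obtain p where "x \<in> W p" ..
        then show ?thesis by (intro UN_I[of "prod_encode p"]) auto
      qed
      then show "A \<union> B \<subseteq> (\<Union>k. W (prod_decode k))" by blast
    qed (use U V assms in \<open>auto simp: W_def split: prod.splits\<close>)
    also have "\<dots> = (\<Sum>i. \<Sum>j. diam_pow s (W (i, j)))"
      by (rule suminf_ennreal_2dimen[of _ "\<lambda>p. diam_pow s (W p)"]) simp
    also have "\<dots> = (\<Sum>i\<in>{0, 1::nat}. \<Sum>j. diam_pow s (W (i, j)))"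
      by (intro suminf_finite) (auto simp: W_def)
    finally show ?thesis by (simp add: W_def)
  qed
  show ?thesis
  proof (rule ennreal_le_epsilon)
    fix e :: real
    assume fin: "hausdorff_premeasure s d A + hausdorff_premeasure s d B < top" and e: "0 < e"
    have A: "hausdorff_premeasure s d A < \<infinity>" and B: "hausdorff_premeasure s d B < \<infinity>"
      using fin by (auto simp: less_top[symmetric])
    obtain U where U: "A \<subseteq> (\<Union>k. U k)" "\<And>k. bounded (U k)" "\<And>k. diameter (U k) \<le> d"
        "(\<Sum>k. diam_pow s (U k)) \<le> hausdorff_premeasure s d A + ennreal (e / 2)"
      using hausdorff_premeasure_approx[OF A, of "e / 2"] e by auto
    obtain V where V: "B \<subseteq> (\<Union>k. V k)" "\<And>k. bounded (V k)" "\<And>k. diameter (V k) \<le> d"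
        "(\<Sum>k. diam_pow s (V k)) \<le> hausdorff_premeasure s d B + ennreal (e / 2)"
      using hausdorff_premeasure_approx[OF B, of "e / 2"] e by auto
    have "hausdorff_premeasure s d (A \<union> B)
        \<le> (hausdorff_premeasure s d A + ennreal (e / 2)) + (hausdorff_premeasure s d B + ennreal (e / 2))"
      by (rule order_trans[OF main[OF U(1-3) V(1-3)] add_mono[OF U(4) V(4)]])
    also have "\<dots> = hausdorff_premeasure s d A + hausdorff_premeasure s d B + ennreal e"
      using e ennreal_plus[of "e / 2" "e / 2"] by (simp add: ac_simps)
    finally show "hausdorff_premeasure s d (A \<union> B)
        \<le> hausdorff_premeasure s d A + hausdorff_premeasure s d B + ennreal e" .
  qed
qed

lemma hausdorff_premeasure_UN:
  fixes A :: "'b \<Rightarrow> 'a::metric_space set"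
  assumes "d \<ge> 0" "finite I"
  shows "hausdorff_premeasure s d (\<Union>i\<in>I. A i) \<le> (\<Sum>i\<in>I. hausdorff_premeasure s d (A i))"
  using assms(2)
proof induction
  case empty
  then show ?case using assms by (simp add: hausdorff_premeasure_empty)
next
  case (insert i I)
  then show ?case
    using order_trans[OF hausdorff_premeasure_Un[OF assms(1)] add_left_mono] by simp
qed

lemma hausdorff_measure_Un:
  "hausdorff_measure s (A \<union> B) \<le> hausdorff_measure s A + hausdorff_measure s B"
  by (intro hausdorff_measure_le order_trans[OF hausdorff_premeasure_Un] add_mono
        hausdorff_premeasure_le_measure) auto

lemma hausdorff_measure_singleton:
  assumes "s > 0" shows "hausdorff_measure s {x} = 0"
proof -
  have "hausdorff_premeasure s d {x} \<le> 0" if "d > 0" for d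
  proof -
    have "hausdorff_premeasure s d {x} \<le> (\<Sum>k::nat. diam_pow s {x})"
      by (rule hausdorff_premeasure_leI) (use that in auto)
    then show ?thesis using assms by (simp add: diam_pow_def)
  qed
  then show ?thesis using hausdorff_measure_le[of s "{x}" 0] by simp
qed

lemma diameter_affine_image_le:
  fixes U :: "real set"
  assumes "c > 0" "bounded U"
  shows "diameter ((\<lambda>x. c * x + t) ` U) \<le> c * diameter U"
proof (cases "U = {}")
  case False
  have "dist (c * x + t) (c * y + t) \<le> c * diameter U" if "x \<in> U" "y \<in> U" for x y
    using diameter_bounded_bound[OF assms(2) that] assms(1)
    by (simp add: dist_real_def abs_mult flip: right_diff_distrib)
  then show ?thesis using False by (intro diameter_le) (auto simp: dist_real_def)
qed simp

lemma hausdorff_premeasure_affine: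
  fixes A :: "real set"
  assumes "c > 0" "s > 0"
  shows "hausdorff_premeasure s (c * d) ((\<lambda>x. c * x + t) ` A) \<le> ennreal (c powr s) * hausdorff_premeasure s d A"
proof -
  let ?f = "\<lambda>x. c * x + t"
  have *: "hausdorff_premeasure s (c * d) (?f ` A) \<le> ennreal (c powr s) * (\<Sum>k. diam_pow s (U k))"
    if U: "A \<subseteq> (\<Union>k. U k)" "\<And>k. bounded (U k)" "\<And>k. diameter (U k) \<le> d" for U :: "nat \<Rightarrow> real set"
  proof -
    have bounded: "bounded (?f ` U k)" for k
      using bounded_translation[OF bounded_scaling[OF U(2)[of k], of c], of t]
      by (simp add: image_image add.commute)
    have "hausdorff_premeasure s (c * d) (?f ` A) \<le> (\<Sum>k. diam_pow s (?f ` U k))"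
    proof (rule hausdorff_premeasure_leI)
      show "?f ` A \<subseteq> (\<Union>k. ?f ` U k)" using U(1) by blast
      show "bounded (?f ` U k)" for k
        by (rule bounded)
      show "diameter (?f ` U k) \<le> c * d" for k
        using diameter_affine_image_le[OF assms(1) U(2)[of k], of t] U(3)[of k] assms(1)
        by (meson mult_left_mono less_imp_le order_trans)
    qed
    also have "\<dots> \<le> (\<Sum>k. ennreal (c powr s) * diam_pow s (U k))"
    proof (intro suminf_le allI)
      fix k
      have "diameter (?f ` U k) powr s \<le> (c * diameter (U k)) powr s"
        using diameter_affine_image_le[OF assms(1) U(2)[of k], of t] assms
        by (intro powr_mono2) (auto intro!: diameter_ge_0 bounded)
      then show "diam_pow s (?f ` U k) \<le> ennreal (c powr s) * diam_pow s (U k)"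
        using assms U(2)[of k]
        by (auto simp: diam_pow_def powr_mult diameter_ge_0 simp flip: ennreal_mult intro!: ennreal_leI)
    qed auto
    finally show ?thesis by simp
  qed
  show ?thesis
  proof (rule ennreal_le_epsilon)
    fix e :: real
    assume fin: "ennreal (c powr s) * hausdorff_premeasure s d A < top" and e: "0 < e"
    have A: "hausdorff_premeasure s d A < \<infinity>"
      using fin assms by (auto simp: ennreal_mult_less_top)
    define e' where "e' = e / c powr s"
    have e': "e' > 0" "c powr s * e' = e" using e assms by (auto simp: e'_def)
    obtain U where U: "A \<subseteq> (\<Union>k. U k)" "\<And>k. bounded (U k)" "\<And>k. diameter (U k) \<le> d"
        "(\<Sum>k. diam_pow s (U k)) \<le> hausdorff_premeasure s d A + ennreal e'"
      using hausdorff_premeasure_approx[OF A e'(1)] by auto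
    have "hausdorff_premeasure s (c * d) (?f ` A) \<le> ennreal (c powr s) * (hausdorff_premeasure s d A + ennreal e')"
      by (rule order_trans[OF *[OF U(1-3)] mult_left_mono[OF U(4)]]) auto
    also have "\<dots> = ennreal (c powr s) * hausdorff_premeasure s d A + ennreal e"
      using e' by (simp add: distrib_left flip: ennreal_mult)
    finally show "hausdorff_premeasure s (c * d) (?f ` A) \<le> ennreal (c powr s) * hausdorff_premeasure s d A + ennreal e" .
  qed
qed

lemma hausdorff_measure_affine_le:
  fixes A :: "real set"
  assumes "c > 0" "s > 0"
  shows "hausdorff_measure s ((\<lambda>x. c * x + t) ` A) \<le> ennreal (c powr s) * hausdorff_measure s A"
proof (rule hausdorff_measure_le)
  fix d :: real assume d: "d > 0"
  have "hausdorff_premeasure s d ((\<lambda>x. c * x + t) ` A) \<le> ennreal (c powr s) * hausdorff_premeasure s (d / c) A"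
    using hausdorff_premeasure_affine[OF assms, of "d / c" t A] assms by simp
  also have "\<dots> \<le> ennreal (c powr s) * hausdorff_measure s A"
    using d assms by (intro mult_left_mono hausdorff_premeasure_le_measure) auto
  finally show "hausdorff_premeasure s d ((\<lambda>x. c * x + t) ` A) \<le> ennreal (c powr s) * hausdorff_measure s A" .
qed

lemma hausdorff_measure_affine:
  fixes A :: "real set"
  assumes "c > 0" "s > 0"
  shows "hausdorff_measure s ((\<lambda>x. c * x + t) ` A) = ennreal (c powr s) * hausdorff_measure s A"
proof (rule antisym[OF hausdorff_measure_affine_le[OF assms]])
  let ?B = "(\<lambda>x. c * x + t) ` A"
  have "A = (\<lambda>x. (1 / c) * x + (- t / c)) ` ?B"
    using assms by (auto simp: image_image add_divide_distrib divide_simps)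
  then have "hausdorff_measure s A \<le> ennreal ((1 / c) powr s) * hausdorff_measure s ?B"
    using hausdorff_measure_affine_le[of "1 / c" s "- t / c" ?B] assms by simp
  then have "ennreal (c powr s) * hausdorff_measure s A
      \<le> ennreal (c powr s) * (ennreal ((1 / c) powr s) * hausdorff_measure s ?B)"
    by (rule mult_left_mono) auto
  also have "\<dots> = ennreal (c powr s * (1 / c) powr s) * hausdorff_measure s ?B"
    by (simp add: mult.assoc ennreal_mult)
  also have "c powr s * (1 / c) powr s = 1"
    using assms by (simp add: powr_divide)
  finally show "ennreal (c powr s) * hausdorff_measure s A \<le> hausdorff_measure s ?B" by simp
qed

text \<open>A cover of \<open>A\<close> splits into covers of the two halves, except that the sets straddling \<open>b\<close> would be
counted twice. However many they are, all of them lie in \<open>[b - d, b + d]\<close>, so the two intervals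
\<open>[b - d, b]\<close> and \<open>[b, b + d]\<close> replace them at the cost \<open>2 d\<^sup>s\<close>, which vanishes as \<open>d\<close> tends to 0.\<close>

lemma hausdorff_premeasure_cut:
  fixes A :: "real set"
  assumes "s > 0" "d > 0"
  shows "hausdorff_premeasure s d (A \<inter> {..b}) + hausdorff_premeasure s d (A \<inter> {b..})
    \<le> hausdorff_premeasure s d A + ennreal (2 * d powr s)"
proof -
  have *: "hausdorff_premeasure s d (A \<inter> {..b}) + hausdorff_premeasure s d (A \<inter> {b..})
    \<le> (\<Sum>k. diam_pow s (U k)) + ennreal (2 * d powr s)"
    if U: "A \<subseteq> (\<Union>k. U k)" "\<And>k. bounded (U k)" "\<And>k. diameter (U k) \<le> d" for U :: "nat \<Rightarrow> real set"
  proof -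
    define L where "L = (\<lambda>k. if U k \<subseteq> {..b} then U k else {})"
    define R where "R = (\<lambda>k. if \<not> U k \<subseteq> {..b} \<and> U k \<subseteq> {b..} then U k else {})"
    have near: "\<bar>x - z\<bar> \<le> d" if "x \<in> U k" "z \<in> U k" for x z k
      using diameter_bounded_bound[OF U(2) that] U(3)[of k] by (simp add: dist_real_def)
    have "A \<inter> {..b} \<subseteq> (\<Union>k. case_nat {b - d..b} L k)"
    proof
      fix x assume x: "x \<in> A \<inter> {..b}"
      then obtain k where k: "x \<in> U k" using U(1) by auto
      show "x \<in> (\<Union>k. case_nat {b - d..b} L k)"
      proof (cases "U k \<subseteq> {..b}")
        case True
        then show ?thesis using k by (intro UN_I[of "Suc k"]) (auto simp: L_def)
      next
        case False
        then obtain z where "z \<in> U k" "z > b" by (auto simp: subset_eq not_le)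
        then show ?thesis using near[OF k, of z] x by (intro UN_I[of 0]) auto
      qed
    qed
    then have 1: "hausdorff_premeasure s d (A \<inter> {..b}) \<le> (\<Sum>k. diam_pow s (case_nat {b - d..b} L k))"
      by (rule hausdorff_premeasure_leI)
        (use U assms in \<open>auto simp: L_def diameter_closed_interval split: nat.splits\<close>)
    have "A \<inter> {b..} \<subseteq> (\<Union>k. case_nat {b..b + d} R k)"
    proof
      fix x assume x: "x \<in> A \<inter> {b..}"
      then obtain k where k: "x \<in> U k" using U(1) by auto
      consider "U k \<subseteq> {..b}" | "\<not> U k \<subseteq> {..b}" "U k \<subseteq> {b..}" | "\<not> U k \<subseteq> {b..}" by blast
      then show "x \<in> (\<Union>k. case_nat {b..b + d} R k)"
      proof cases
        case 1
        then show ?thesis using k x assms by (intro UN_I[of 0]) force+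
      next
        case 2
        then show ?thesis using k by (intro UN_I[of "Suc k"]) (auto simp: R_def)
      next
        case 3
        then obtain z where "z \<in> U k" "z < b" by (auto simp: subset_eq not_le)
        then show ?thesis using near[OF k, of z] x by (intro UN_I[of 0]) auto
      qed
    qed
    then have 2: "hausdorff_premeasure s d (A \<inter> {b..}) \<le> (\<Sum>k. diam_pow s (case_nat {b..b + d} R k))"
      by (rule hausdorff_premeasure_leI)
        (use U assms in \<open>auto simp: R_def diameter_closed_interval split: nat.splits\<close>)
    have split: "(\<Sum>k. diam_pow s (case_nat I V k)) \<le> ennreal (d powr s) + (\<Sum>k. diam_pow s (V k))"
      if "bounded I" "diameter I \<le> d" for I and V :: "nat \<Rightarrow> real set"
    proof -
      have "(\<Sum>k. diam_pow s (case_nat I V k)) = diam_pow s I + (\<Sum>k. diam_pow s (V k))"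
        by (subst suminf_offset[of _ "Suc 0"]) auto
      then show ?thesis using diam_pow_le[OF assms(1) that] by (simp add: add_right_mono)
    qed
    have "hausdorff_premeasure s d (A \<inter> {..b}) + hausdorff_premeasure s d (A \<inter> {b..})
       \<le> (ennreal (d powr s) + (\<Sum>k. diam_pow s (L k))) + (ennreal (d powr s) + (\<Sum>k. diam_pow s (R k)))"
      using assms by (intro add_mono order_trans[OF 1 split] order_trans[OF 2 split])
        (auto simp: diameter_closed_interval)
    also have "\<dots> = (\<Sum>k. diam_pow s (L k) + diam_pow s (R k)) + ennreal (2 * d powr s)"
    proof -
      have "ennreal (2 * d powr s) = ennreal (d powr s) + ennreal (d powr s)"
        by (simp flip: ennreal_plus)
      moreover have "(\<Sum>k. diam_pow s (L k) + diam_pow s (R k)) = (\<Sum>k. diam_pow s (L k)) + (\<Sum>k. diam_pow s (R k))"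
        by (intro suminf_add[symmetric]) auto
      ultimately show ?thesis by (simp add: ac_simps)
    qed
    also have "(\<Sum>k. diam_pow s (L k) + diam_pow s (R k)) \<le> (\<Sum>k. diam_pow s (U k))"
      by (intro suminf_le) (auto simp: L_def R_def)
    finally show ?thesis by (simp add: add_right_mono)
  qed
  show ?thesis
  proof (rule ennreal_le_epsilon)
    fix e :: real
    assume fin: "hausdorff_premeasure s d A + ennreal (2 * d powr s) < top" and e: "0 < e"
    have A: "hausdorff_premeasure s d A < \<infinity>"
      using fin by auto
    obtain U where U: "A \<subseteq> (\<Union>k. U k)" "\<And>k. bounded (U k)" "\<And>k. diameter (U k) \<le> d"
        "(\<Sum>k. diam_pow s (U k)) \<le> hausdorff_premeasure s d A + ennreal e"
      using hausdorff_premeasure_approx[OF A e] by auto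
    have "hausdorff_premeasure s d (A \<inter> {..b}) + hausdorff_premeasure s d (A \<inter> {b..})
        \<le> (hausdorff_premeasure s d A + ennreal e) + ennreal (2 * d powr s)"
      by (rule order_trans[OF *[OF U(1-3)] add_right_mono[OF U(4)]])
    then show "hausdorff_premeasure s d (A \<inter> {..b}) + hausdorff_premeasure s d (A \<inter> {b..})
        \<le> hausdorff_premeasure s d A + ennreal (2 * d powr s) + ennreal e"
      by (simp add: ac_simps)
  qed
qed

text \<open>Additivity across a point is all the additivity that the argument uses: it makes
\<open>\<H>\<^sup>s(A \<inter> [a, b])\<close> an additive function of intervals for every set \<open>A\<close>, without measurability.\<close>

lemma hausdorff_measure_cut:
  fixes A :: "real set"
  assumes "s > 0"
  shows "hausdorff_measure s A = hausdorff_measure s (A \<inter> {..b}) + hausdorff_measure s (A \<inter> {b..})"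
proof (rule antisym)
  have "A = (A \<inter> {..b}) \<union> (A \<inter> {b..})" by auto
  then show "hausdorff_measure s A \<le> hausdorff_measure s (A \<inter> {..b}) + hausdorff_measure s (A \<inter> {b..})"
    using hausdorff_measure_Un by metis
next
  let ?l = "\<lambda>d. hausdorff_premeasure s d (A \<inter> {..b})" and ?r = "\<lambda>d. hausdorff_premeasure s d (A \<inter> {b..})"
  have bound: "?l d1 + ?r d2 \<le> hausdorff_measure s A" if d: "d1 > 0" "d2 > 0" for d1 d2
  proof (rule ennreal_le_epsilon)
    fix e :: real assume e: "0 < e"
    define d where "d = min (min d1 d2) ((e / 2) powr (1 / s))"
    have d0: "d > 0" using d e by (auto simp: d_def)
    have "d powr s \<le> ((e / 2) powr (1 / s)) powr s"
      using d0 assms by (intro powr_mono2) (auto simp: d_def)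
    also have "\<dots> = e / 2" using assms e by (simp add: powr_powr)
    finally have de: "2 * d powr s \<le> e" by simp
    have "?l d1 + ?r d2 \<le> ?l d + ?r d"
      by (intro add_mono hausdorff_premeasure_antimono) (auto simp: d_def)
    also have "\<dots> \<le> hausdorff_premeasure s d A + ennreal (2 * d powr s)"
      by (rule hausdorff_premeasure_cut[OF assms d0])
    also have "\<dots> \<le> hausdorff_measure s A + ennreal e"
      using de d0 by (intro add_mono hausdorff_premeasure_le_measure ennreal_leI) auto
    finally show "?l d1 + ?r d2 \<le> hausdorff_measure s A + ennreal e" .
  qed
  have "hausdorff_measure s (A \<inter> {..b}) + hausdorff_measure s (A \<inter> {b..})
      = (SUP d1\<in>{0<..}. SUP d2\<in>{0<..}. ?l d1 + ?r d2)"
    unfolding hausdorff_measure_def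
    by (subst ennreal_SUP_add_left[symmetric]) (auto simp: ennreal_SUP_add_right)
  also have "\<dots> \<le> hausdorff_measure s A"
    by (intro SUP_least bound) auto
  finally show "hausdorff_measure s (A \<inter> {..b}) + hausdorff_measure s (A \<inter> {b..}) \<le> hausdorff_measure s A" .
qed

text \<open>Finite sets are null for \<open>s > 0\<close>; hence it never matters whether the end points of a cell belong
to it.\<close>

lemma hausdorff_measure_Un_finite:
  assumes "s > 0" "finite P" "A \<subseteq> B" "B \<subseteq> A \<union> P"
  shows "hausdorff_measure s B = hausdorff_measure s A"
proof -
  have "hausdorff_measure s (A \<union> P) \<le> hausdorff_measure s A"
    using assms(2)
  proof induction
    case (insert x P)
    have "hausdorff_measure s (A \<union> insert x P) \<le> hausdorff_measure s {x} + hausdorff_measure s (A \<union> P)"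
      using hausdorff_measure_Un[of s "{x}" "A \<union> P"] by simp
    then show ?case using insert by (simp add: hausdorff_measure_singleton assms(1))
  qed simp
  then show ?thesis
    using hausdorff_measure_mono[OF assms(3), of s] hausdorff_measure_mono[OF assms(4), of s] by order
qed

text \<open>If the part of \<open>F\<close> over the cell \<open>(i / b, (i + 1) / b)\<close> is a copy of \<open>G\<close> scaled by \<open>1 / b\<close>, the
scaling law determines its measure. Only interior points are compared, because a neighbouring
cell may contribute the end points.\<close>

lemma hausdorff_measure_open_cell:
  fixes F G :: "real set"
  assumes "s > 0" "b > 0" "G \<subseteq> {0..1}"
    and cell: "\<And>x. 0 < x \<Longrightarrow> x < 1 \<Longrightarrow> (i + x) / b \<in> F \<longleftrightarrow> x \<in> G"
  shows "hausdorff_measure s (F \<inter> {i / b..(i + 1) / b}) = ennreal ((1 / b) powr s) * hausdorff_measure s G"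
proof -
  define G' where "G' = G \<inter> {0<..<1}"
  have "hausdorff_measure s (F \<inter> {i / b..(i + 1) / b}) = hausdorff_measure s ((\<lambda>x. 1 / b * x + i / b) ` G')"
  proof (rule hausdorff_measure_Un_finite[of _ "{i / b, (i + 1) / b}"])
    show "(\<lambda>x. 1 / b * x + i / b) ` G' \<subseteq> F \<inter> {i / b..(i + 1) / b}"
    proof (rule image_subsetI)
      fix x assume x: "x \<in> G'"
      have "1 / b * x + i / b = (i + x) / b" by (simp add: add_divide_distrib)
      then show "1 / b * x + i / b \<in> F \<inter> {i / b..(i + 1) / b}"
        using x cell[of x] assms(2) by (auto simp: G'_def divide_right_mono)
    qed
    show "F \<inter> {i / b..(i + 1) / b} \<subseteq> (\<lambda>x. 1 / b * x + i / b) ` G' \<union> {i / b, (i + 1) / b}"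
    proof
      fix w assume w: "w \<in> F \<inter> {i / b..(i + 1) / b}"
      define x where "x = b * w - i"
      have wx: "w = (i + x) / b" using assms(2) by (simp add: x_def)
      show "w \<in> (\<lambda>x. 1 / b * x + i / b) ` G' \<union> {i / b, (i + 1) / b}"
      proof (cases "w = i / b \<or> w = (i + 1) / b")
        case False
        then have "0 < x" "x < 1"
          using w assms(2) unfolding wx by (auto simp: divide_le_cancel less_le)
        then have "x \<in> G'" using cell[of x] w wx by (simp add: G'_def)
        then show ?thesis unfolding wx by (intro UnI1 image_eqI[of _ _ x]) (auto simp: add_divide_distrib)
      qed auto
    qed
  qed (use assms in auto)
  also have "\<dots> = ennreal ((1 / b) powr s) * hausdorff_measure s G'"
    by (rule hausdorff_measure_affine) (use assms in auto)
  also have "hausdorff_measure s G' = hausdorff_measure s G"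
    by (rule sym, rule hausdorff_measure_Un_finite[of _ "{0, 1}"]) (use assms in \<open>auto simp: G'_def less_le\<close>)
  finally show ?thesis .
qed

lemma hausdorff_measure_sum_cells:
  fixes A :: "real set"
  assumes "s > 0" "b > 0"
  shows "hausdorff_measure s (A \<inter> {0..real k / b})
    = (\<Sum>r<k. hausdorff_measure s (A \<inter> {real r / b..(real r + 1) / b}))"
proof (induction k)
  case 0
  have "hausdorff_measure s (A \<inter> {0}) \<le> 0"
    using hausdorff_measure_mono[of "A \<inter> {0}" "{0}" s] hausdorff_measure_singleton[OF assms(1), of "0 :: real"] by simp
  then show ?case by simp
next
  case (Suc k)
  have le: "real k / b \<le> (real k + 1) / b" using assms by (simp add: divide_right_mono)
  have 0: "0 \<le> real k / b" using assms by simp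
  have "A \<inter> {0..real (Suc k) / b} \<inter> {..real k / b} = A \<inter> {0..real k / b}"
    "A \<inter> {0..real (Suc k) / b} \<inter> {real k / b..} = A \<inter> {real k / b..(real k + 1) / b}"
    using le 0 by (auto simp: add.commute)
  then show ?case
    using hausdorff_measure_cut[OF assms(1), of "A \<inter> {0..real (Suc k) / b}" "real k / b"] Suc by simp
qed

lemma hausdorff_premeasure_unit_le_1:
  fixes A :: "real set"
  assumes "A \<subseteq> {0..1}" "1 \<le> d" "0 < s"
  shows "hausdorff_premeasure s d A \<le> 1"
proof -
  define U where "U k = (if k = 0 then {0..1} else {} :: real set)" for k :: nat
  have "hausdorff_premeasure s d A \<le> (\<Sum>k. diam_pow s (U k))"
    by (rule hausdorff_premeasure_leI) (use assms in \<open>auto simp: U_def\<close>)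
  also have "\<dots> = (\<Sum>k\<in>{0}. diam_pow s (U k))" by (rule suminf_finite) (auto simp: U_def)
  also have "\<dots> = 1" using assms by (simp add: U_def diam_pow_def)
  finally show ?thesis .
qed

text \<open>Covering \<open>T l\<close> by at most \<open>b\<^sup>s\<close> copies of \<open>T (l + 1)\<close> scaled by \<open>1 / b\<close> does not increase the
\<open>s\<close>-dimensional cost and refines the scale by the factor \<open>b\<close>. So a cover at scale \<open>d\<close> costs no more
than one of a later \<open>T (l + q)\<close> at scale \<open>b\<^sup>q d \<ge> 1\<close>, and there the unit interval alone suffices.\<close>

lemma hausdorff_measure_moran_le_1:
  fixes T :: "nat \<Rightarrow> real set" and D :: "nat \<Rightarrow> nat set"
  assumes "0 < s" "1 < b" and unit: "\<And>l. T l \<subseteq> {0..1}"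
    and cover: "\<And>l. T l \<subseteq> (\<Union>r\<in>D l. (\<lambda>x. 1 / b * x + real r / b) ` T (Suc l))"
    and D: "\<And>l. finite (D l)" "\<And>l. real (card (D l)) \<le> b powr s"
  shows "hausdorff_measure s (T l) \<le> 1"
proof (rule hausdorff_measure_le)
  fix d :: real assume d: "0 < d"
  have step: "hausdorff_premeasure s d (T l) \<le> hausdorff_premeasure s (b * d) (T (Suc l))" if "0 < d" for d l
  proof -
    let ?X = "hausdorff_premeasure s (b * d) (T (Suc l))"
    have "hausdorff_premeasure s d (T l) \<le> hausdorff_premeasure s d (\<Union>r\<in>D l. (\<lambda>x. 1 / b * x + real r / b) ` T (Suc l))"
      by (rule hausdorff_premeasure_mono[OF cover])
    also have "\<dots> \<le> (\<Sum>r\<in>D l. hausdorff_premeasure s d ((\<lambda>x. 1 / b * x + real r / b) ` T (Suc l)))"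
      by (rule hausdorff_premeasure_UN) (use that D in auto)
    also have "\<dots> \<le> (\<Sum>r\<in>D l. ennreal ((1 / b) powr s) * ?X)"
    proof (rule sum_mono)
      fix r
      show "hausdorff_premeasure s d ((\<lambda>x. 1 / b * x + real r / b) ` T (Suc l)) \<le> ennreal ((1 / b) powr s) * ?X"
        using hausdorff_premeasure_affine[of "1 / b" s "b * d" "real r / b" "T (Suc l)"] assms(1,2) by simp
    qed
    also have "\<dots> = ennreal (real (card (D l)) * (1 / b) powr s) * ?X"
      by (simp add: ennreal_mult ennreal_of_nat_eq_real_of_nat mult.assoc)
    also have "\<dots> \<le> ennreal 1 * ?X"
      using D(2)[of l] assms(2) by (intro mult_right_mono ennreal_leI) (auto simp: powr_divide)
    finally show ?thesis by simp
  qed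
  have iter: "hausdorff_premeasure s d (T l) \<le> hausdorff_premeasure s (b ^ q * d) (T (l + q))" for q
  proof (induction q)
    case (Suc q)
    then show ?case using step[of "b ^ q * d" "l + q"] d assms(2) by (simp add: mult.assoc)
  qed simp
  obtain q where "1 / d < b ^ q" using real_arch_pow[OF assms(2)] by blast
  then have "1 \<le> b ^ q * d" using d by (simp add: field_simps)
  then show "hausdorff_premeasure s d (T l) \<le> 1"
    using iter[of q] hausdorff_premeasure_unit_le_1[OF unit _ assms(1)] order_trans by blast
qed

section \<open>Commensurability for quantized masses\<close>

text \<open>Here \<open>M a b\<close> stands for \<open>\<H>\<^sup>\<alpha>(F \<inter> [a, b])\<close>, where \<open>F\<close> is mapped into itself by
\<open>x \<mapsto> \<rho> x + c\<close>. The axioms record what the commensurability argument needs: additivity, the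
quantization of the masses of \<open>n\<close>-adic cells, and the fact that the image of an interval carries at
least the scaled mass of the interval, with equality not required since other parts of \<open>F\<close> may also
meet the image. The strict inequality \<open>N < n\<close> is essential: for \<open>N = n\<close>, hence \<open>\<alpha> = 1\<close>, Lebesgue measure
satisfies all the other axioms for every ratio.\<close>

locale self_mapped_mass =
  fixes n N l0 :: nat and M :: "real \<Rightarrow> real \<Rightarrow> real" and S :: "real set" and \<rho> c \<alpha> :: real
  assumes N_ge_2: "2 \<le> N" and N_less: "N < n"
    and \<alpha>_def: "\<alpha> = ln (real N) / ln (real n)"
    and \<rho>_pos: "0 < \<rho>" and \<rho>_less: "\<rho> < 1"
    and finite_S: "finite S"
    and M_nonneg: "0 \<le> M a b"
    and M_add: "a \<le> b \<Longrightarrow> b \<le> d \<Longrightarrow> M a d = M a b + M b d"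
    and M_cell: "l0 \<le> l \<Longrightarrow> \<exists>s\<in>S. M (of_int i / real n ^ l) ((of_int i + 1) / real n ^ l) = s / real N ^ l"
    and M_nontrivial: "\<exists>a b. a \<le> b \<and> 0 < M a b"
    and M_push: "a \<le> b \<Longrightarrow> \<rho> powr \<alpha> * M a b \<le> M (\<rho> * a + c) (\<rho> * b + c)"
begin

abbreviation cell :: "nat \<Rightarrow> int \<Rightarrow> real" where
  "cell l i \<equiv> M (of_int i / real n ^ l) ((of_int i + 1) / real n ^ l)"

lemma n_gt_1: "1 < real n" and N_gt_1: "1 < real N"
  using N_ge_2 N_less by auto

lemma n_pos [simp]: "0 < n" and N_pos [simp]: "0 < N"
  using N_ge_2 N_less by auto

lemma \<alpha>_pos: "0 < \<alpha>" and \<alpha>_less_1: "\<alpha> < 1"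
  using n_gt_1 N_gt_1 N_less by (auto simp: \<alpha>_def)

lemma n_pow_powr: "(real n ^ l) powr \<alpha> = real N ^ l"
proof -
  have "real n powr \<alpha> = real N"
    using n_gt_1 N_gt_1 by (simp add: \<alpha>_def powr_def)
  then show ?thesis
    using n_gt_1 by (simp add: powr_power flip: powr_realpow)
       (metis N_gt_1 less_trans mult.commute powr_powr powr_realpow zero_less_one)
qed

lemma M_refl [simp]: "M a a = 0"
  using M_add[of a a a] by simp

lemma M_mono: "a' \<le> a \<Longrightarrow> a \<le> b \<Longrightarrow> b \<le> b' \<Longrightarrow> M a b \<le> M a' b'"
  using M_add[of a' a b'] M_add[of a b b'] M_nonneg[of a' a] M_nonneg[of b b'] by linarith

lemma grid_sum:
  "M (of_int i / real n ^ l) ((of_int i + real k) / real n ^ l) = (\<Sum>t<k. cell l (i + int t))"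
proof (induction k)
  case (Suc k)
  have "M (of_int i / real n ^ l) ((of_int i + real (Suc k)) / real n ^ l)
     = M (of_int i / real n ^ l) ((of_int i + real k) / real n ^ l)
       + M ((of_int i + real k) / real n ^ l) ((of_int i + real (Suc k)) / real n ^ l)"
    by (intro M_add divide_right_mono) auto
  then show ?case using Suc by (simp add: add_ac)
qed simp

text \<open>Every small length \<open>g\<close> equals, up to a factor in \<open>[R, n R)\<close>, the length of the cells of some level
\<open>l \<ge> l0\<close>.\<close>

lemma pick_level:
  assumes "0 < g" "g \<le> 1 / real n ^ l0" "1 \<le> R"
  obtains l where "l0 \<le> l" "R \<le> g * real n ^ l" "g * real n ^ l < real n * R"
proof -
  obtain k where "R / g < real n ^ k" using real_arch_pow[OF n_gt_1] by blast
  then have ex: "R \<le> g * real n ^ k" using assms by (simp add: field_simps)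
  define l where "l = (LEAST l. R \<le> g * real n ^ l)"
  have l: "R \<le> g * real n ^ l" unfolding l_def by (rule LeastI[of _ k]) (rule ex)
  have "l0 \<le> l"
  proof (rule ccontr)
    assume "\<not> l0 \<le> l"
    then have "real n ^ l < real n ^ l0" using n_gt_1 by simp
    then have "g * real n ^ l < g * real n ^ l0" using assms by simp
    also have "\<dots> \<le> 1" using assms(2) by (simp add: pos_le_divide_eq)
    finally show False using l assms by simp
  qed
  moreover have "g * real n ^ l < real n * R"
  proof (cases l)
    case 0
    have "g \<le> 1" using assms(2) \<open>l0 \<le> l\<close> 0 by simp
    also have "1 < real n * R" using n_gt_1 assms(3) by (meson less_le_trans mult_le_cancel_left1 not_less order_trans zero_le_one less_imp_le)
    finally show ?thesis using 0 by simp
  next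
    case (Suc l')
    then have "\<not> R \<le> g * real n ^ l'" using not_less_Least[of l' "\<lambda>l. R \<le> g * real n ^ l"] by (auto simp: l_def)
    then show ?thesis using n_gt_1 Suc by simp
  qed
  ultimately show ?thesis using that l by blast
qed

text \<open>An interval of length comparable to \<open>n\<^sup>-\<^sup>l\<close> meets boundedly many cells of level \<open>l\<close>, each of mass at
most a constant times \<open>N\<^sup>-\<^sup>l = (n\<^sup>-\<^sup>l)\<^sup>\<alpha>\<close>.\<close>

lemma M_upper:
  obtains C where "0 < C" "\<And>a b. a < b \<Longrightarrow> b - a \<le> 1 / real n ^ l0 \<Longrightarrow> M a b \<le> C * (b - a) powr \<alpha>"
proof -
  define B where "B = Max (insert 1 S)"
  have B: "1 \<le> B" "\<And>s. s \<in> S \<Longrightarrow> s \<le> B" using finite_S by (auto simp: B_def)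
  have "M a b \<le> (real n + 1) * B * (b - a) powr \<alpha>" if ab: "a < b" "b - a \<le> 1 / real n ^ l0" for a b
  proof -
    obtain l where l: "l0 \<le> l" "1 \<le> (b - a) * real n ^ l" "(b - a) * real n ^ l < real n * 1"
      using pick_level[of "b - a" 1] ab by auto
    define i where "i = \<lfloor>a * real n ^ l\<rfloor>"
    have i: "of_int i \<le> a * real n ^ l" "a * real n ^ l < of_int i + 1" unfolding i_def by linarith+
    have "M a b \<le> M (of_int i / real n ^ l) ((of_int i + real (n + 1)) / real n ^ l)"
      using i l ab by (intro M_mono) (auto simp: pos_divide_le_eq pos_le_divide_eq left_diff_distrib)
    also have "\<dots> = (\<Sum>t<n + 1. cell l (i + int t))" by (rule grid_sum)
    also have "\<dots> \<le> (\<Sum>t<n + 1. B / real N ^ l)"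
    proof (rule sum_mono)
      fix t
      show "cell l (i + int t) \<le> B / real N ^ l"
        using M_cell[OF l(1), of "i + int t"] B(2) by (auto intro!: divide_right_mono)
    qed
    also have "\<dots> = (real n + 1) * B * (1 / real N ^ l)" by simp
    also have "1 / real N ^ l = (1 / real n ^ l) powr \<alpha>"
      using n_pow_powr[of l] n_gt_1 by (simp add: powr_divide)
    also have "(real n + 1) * B * (1 / real n ^ l) powr \<alpha> \<le> (real n + 1) * B * (b - a) powr \<alpha>"
      using l ab \<alpha>_pos B(1) by (intro mult_left_mono powr_mono2) (auto simp: field_simps)
    finally show ?thesis .
  qed
  then show ?thesis using that[of "(real n + 1) * B"] B(1) by simp
qed

lemma M_lower:
  obtains \<sigma> where "0 < \<sigma>"
    "\<And>l i. l0 \<le> l \<Longrightarrow> cell l i \<noteq> 0 \<Longrightarrow> \<sigma> / real N ^ l \<le> cell l i"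
proof -
  define \<sigma> where "\<sigma> = Min (insert 1 {s \<in> S. 0 < s})"
  have \<sigma>: "0 < \<sigma>" "\<And>s. s \<in> S \<Longrightarrow> 0 < s \<Longrightarrow> \<sigma> \<le> s"
    using finite_S by (auto simp: \<sigma>_def)
  have "\<sigma> / real N ^ l \<le> cell l i" if l: "l0 \<le> l" and nz: "cell l i \<noteq> 0" for l i
  proof -
    obtain s where s: "s \<in> S" "cell l i = s / real N ^ l" using M_cell[OF l] by blast
    then have "0 < s / real N ^ l" using nz M_nonneg by (metis less_eq_real_def)
    then have "0 < s" by (simp add: zero_less_divide_iff)
    then show ?thesis using s \<sigma>(2)[OF s(1)] by (simp add: divide_right_mono)
  qed
  then show ?thesis using that \<sigma>(1) by blast
qed

lemma ex_nonzero_cell: "\<exists>i. cell l i \<noteq> 0"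
proof (rule ccontr)
  assume "\<nexists>i. cell l i \<noteq> 0"
  then have z: "cell l i = 0" for i by blast
  obtain a b where ab: "a \<le> b" "0 < M a b" using M_nontrivial by blast
  define i where "i = \<lfloor>a * real n ^ l\<rfloor>"
  define k where "k = nat \<lceil>b * real n ^ l - of_int i\<rceil>"
  have "of_int i \<le> a * real n ^ l" unfolding i_def by linarith
  moreover have "b * real n ^ l \<le> of_int i + real k" unfolding k_def by linarith
  ultimately have "M a b \<le> M (of_int i / real n ^ l) ((of_int i + real k) / real n ^ l)"
    using ab by (intro M_mono) (auto simp: pos_divide_le_eq pos_le_divide_eq)
  also have "\<dots> = 0" unfolding grid_sum z by simp
  finally show False using ab by simp
qed

text \<open>\<open>D\<close> is the limit, as \<open>d\<close> tends to 0, of the largest density \<open>M a b / (b - a)\<^sup>\<alpha>\<close> of intervals of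
length at most \<open>d\<close>. It is finite by the upper bound on masses and positive because every level has a
cell of nonzero mass. The supremum over \<open>d\<close> decreases to \<open>D\<close>, so at a suitable \<open>d\<close> no density exceeds
\<open>(1 + \<epsilon>) D\<close>, although some density exceeds \<open>(1 - \<epsilon>) D\<close>. The point is that \<open>D\<close> does not depend on
\<open>\<epsilon>\<close>.\<close>

lemma near_extremal_interval:
  obtains D where "0 < D"
    "\<And>\<epsilon>. 0 < \<epsilon> \<Longrightarrow> \<exists>d u v. d \<le> 1 / real n ^ l0 \<and> u < v \<and> v - u \<le> d
        \<and> (\<forall>a b. a < b \<and> b - a \<le> d \<longrightarrow> M a b \<le> (1 + \<epsilon>) * D * (b - a) powr \<alpha>)
        \<and> (1 - \<epsilon>) * D * (v - u) powr \<alpha> \<le> M u v"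
proof -
  obtain C where C: "0 < C" "\<And>a b. a < b \<Longrightarrow> b - a \<le> 1 / real n ^ l0 \<Longrightarrow> M a b \<le> C * (b - a) powr \<alpha>"
    using M_upper by blast
  obtain \<sigma> where \<sigma>: "0 < \<sigma>" "\<And>l i. l0 \<le> l \<Longrightarrow> cell l i \<noteq> 0 \<Longrightarrow> \<sigma> / real N ^ l \<le> cell l i"
    using M_lower by blast
  define d0 where "d0 = 1 / real n ^ l0"
  have d0: "0 < d0" by (simp add: d0_def)
  define Q where "Q d = {M a b / (b - a) powr \<alpha> | a b. a < b \<and> b - a \<le> d}" for d
  have bdd: "bdd_above (Q d)" if "d \<le> d0" for d
  proof (rule bdd_aboveI[of _ C])
    fix q assume "q \<in> Q d"
    then obtain a b where "q = M a b / (b - a) powr \<alpha>" "a < b" "b - a \<le> d" by (auto simp: Q_def)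
    then show "q \<le> C" using C(2)[of a b] that by (simp add: d0_def pos_divide_le_eq)
  qed
  have Q_in: "\<exists>q\<in>Q d. \<sigma> \<le> q" if "0 < d" "d \<le> d0" for d
  proof -
    obtain l where l: "l0 \<le> l" "1 \<le> d * real n ^ l"
      using pick_level[of d 1] \<open>0 < d\<close> \<open>d \<le> d0\<close> unfolding d0_def by blast
    obtain i where i: "cell l i \<noteq> 0" using ex_nonzero_cell by blast
    have len: "(of_int i + 1) / real n ^ l - of_int i / real n ^ l = 1 / real n ^ l"
      by (simp add: diff_divide_distrib[symmetric])
    have "cell l i / (1 / real n ^ l) powr \<alpha> \<in> Q d"
      unfolding Q_def using l len
      by (intro CollectI exI[of _ "of_int i / real n ^ l"] exI[of _ "(of_int i + 1) / real n ^ l"])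
        (auto simp: divide_strict_right_mono pos_divide_le_eq)
    moreover have "\<sigma> \<le> cell l i / (1 / real n ^ l) powr \<alpha>"
      using \<sigma>(2)[OF l(1) i] n_pow_powr[of l] by (simp add: powr_divide field_simps)
    ultimately show ?thesis by blast
  qed
  define f where "f d = Sup (Q d)" for d
  have f_ge: "\<sigma> \<le> f d" if "0 < d" "d \<le> d0" for d
    using Q_in[OF that] bdd[OF that(2)] unfolding f_def by (meson cSup_upper order_trans)
  define D where "D = Inf (f ` {0<..d0})"
  have D_le: "D \<le> f d" if "0 < d" "d \<le> d0" for d
    unfolding D_def using f_ge that by (intro cInf_lower bdd_belowI[of _ \<sigma>]) auto
  have "\<sigma> \<le> D" unfolding D_def using d0 f_ge by (intro cInf_greatest) auto
  then have D: "0 < D" using \<sigma>(1) by simp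
  show ?thesis
  proof (rule that[OF D])
    fix \<epsilon> :: real assume \<epsilon>: "0 < \<epsilon>"
    have "Inf (f ` {0<..d0}) < (1 + \<epsilon>) * D" using D \<epsilon> by (simp add: D_def[symmetric])
    then obtain d where d: "0 < d" "d \<le> d0" "f d < (1 + \<epsilon>) * D"
      using cInf_lessD[of "f ` {0<..d0}" "(1 + \<epsilon>) * D"] d0 by auto
    have "(1 - \<epsilon>) * D < D" using D \<epsilon> by (simp add: left_diff_distrib)
    also have "D \<le> f d" by (rule D_le[OF d(1,2)])
    finally have "\<exists>q\<in>Q d. (1 - \<epsilon>) * D < q"
      using less_cSupD[of "Q d" "(1 - \<epsilon>) * D"] Q_in[OF d(1,2)] unfolding f_def by blast
    then obtain u v where uv: "u < v" "v - u \<le> d" "(1 - \<epsilon>) * D < M u v / (v - u) powr \<alpha>"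
      by (auto simp: Q_def)
    have "M a b \<le> (1 + \<epsilon>) * D * (b - a) powr \<alpha>" if ab: "a < b" "b - a \<le> d" for a b
    proof -
      have "M a b / (b - a) powr \<alpha> \<le> f d"
        unfolding f_def using ab by (intro cSup_upper bdd d) (auto simp: Q_def)
      then have "M a b / (b - a) powr \<alpha> \<le> (1 + \<epsilon>) * D" using d(3) by linarith
      then show ?thesis using ab by (simp add: pos_divide_le_eq)
    qed
    moreover have "(1 - \<epsilon>) * D * (v - u) powr \<alpha> \<le> M u v"
      using uv by (simp add: pos_less_divide_eq less_imp_le)
    ultimately show "\<exists>d u v. d \<le> 1 / real n ^ l0 \<and> u < v \<and> v - u \<le> d
        \<and> (\<forall>a b. a < b \<and> b - a \<le> d \<longrightarrow> M a b \<le> (1 + \<epsilon>) * D * (b - a) powr \<alpha>)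
        \<and> (1 - \<epsilon>) * D * (v - u) powr \<alpha> \<le> M u v"
      using d uv unfolding d0_def by blast
  qed
qed

text \<open>This is where \<open>\<alpha> < 1\<close> enters. With \<open>R = L n\<^sup>l\<close>, an interval of length \<open>\<theta> L\<close> contains about \<open>\<theta> R\<close> cells
of level \<open>l\<close>, while a mass of at most \<open>K L\<^sup>\<alpha>\<close> allows only \<open>O(R\<^sup>\<alpha>)\<close> of them to have nonzero mass. Once
\<open>R\<close> exceeds a threshold \<open>R0\<close> that does not depend on the interval, some cell is massless, and its length
is at least \<open>L / (n R0)\<close>.\<close>

lemma massless_gap:
  assumes "0 < \<theta>" "0 < K"
  obtains \<delta> where "0 < \<delta>"
    "\<And>w L. \<lbrakk>0 < L; L \<le> 1 / real n ^ l0; M w (w + \<theta> * L) \<le> K * L powr \<alpha>\<rbrakk>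
      \<Longrightarrow> \<exists>p\<ge>w. p + \<delta> * L \<le> w + \<theta> * L \<and> M p (p + \<delta> * L) = 0"
proof -
  obtain \<sigma> where \<sigma>: "0 < \<sigma>" "\<And>l i. l0 \<le> l \<Longrightarrow> cell l i \<noteq> 0 \<Longrightarrow> \<sigma> / real N ^ l \<le> cell l i"
    using M_lower by blast
  \<comment> \<open>For \<open>R \<ge> R0\<close> this yields \<open>\<theta> R\<^sup>1\<^sup>-\<^sup>\<alpha> \<ge> K / \<sigma> + 2\<close>; the 2 absorbs the cells cut off at the two ends.\<close>
  define R0 where "R0 = max 1 (((K / \<sigma> + 2) / \<theta>) powr (1 / (1 - \<alpha>)))"
  have R0: "1 \<le> R0" by (simp add: R0_def)
  have sublinear: "K / \<sigma> * R powr \<alpha> \<le> \<theta> * R - 2" if R: "R0 \<le> R" for R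
  proof -
    have R1: "1 \<le> R" using R R0 by linarith
    have "(K / \<sigma> + 2) / \<theta> = (((K / \<sigma> + 2) / \<theta>) powr (1 / (1 - \<alpha>))) powr (1 - \<alpha>)"
      using assms \<sigma> \<alpha>_less_1 by (simp add: powr_powr)
    also have "\<dots> \<le> R powr (1 - \<alpha>)"
      using R \<alpha>_less_1 by (intro powr_mono2) (auto simp: R0_def)
    finally have "K / \<sigma> + 2 \<le> \<theta> * R powr (1 - \<alpha>)" using assms by (simp add: pos_divide_le_eq mult.commute)
    then have "(K / \<sigma> + 2) * R powr \<alpha> \<le> \<theta> * R powr (1 - \<alpha>) * R powr \<alpha>"
      by (rule mult_right_mono) simp
    also have "\<dots> = \<theta> * R" using R1 by (simp add: mult.assoc flip: powr_add)
    finally have "K / \<sigma> * R powr \<alpha> + 2 * R powr \<alpha> \<le> \<theta> * R" by (simp add: distrib_right)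
    moreover have "1 \<le> R powr \<alpha>" using R1 \<alpha>_pos by (simp add: ge_one_powr_ge_zero)
    ultimately show ?thesis by linarith
  qed
  show ?thesis
  proof (rule that[of "1 / (real n * R0)"])
    show "0 < 1 / (real n * R0)" using R0 n_gt_1 by simp
    fix w L :: real
    assume L: "0 < L" "L \<le> 1 / real n ^ l0" and small: "M w (w + \<theta> * L) \<le> K * L powr \<alpha>"
    obtain l where l: "l0 \<le> l" "R0 \<le> L * real n ^ l" "L * real n ^ l < real n * R0"
      using pick_level[OF L R0] by blast
    define i where "i = \<lceil>w * real n ^ l\<rceil>"
    define k where "k = nat \<lfloor>\<theta> * (L * real n ^ l) - 1\<rfloor>"
    have i: "w * real n ^ l \<le> of_int i" "of_int i \<le> w * real n ^ l + 1" unfolding i_def by linarith+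
    have sub: "K / \<sigma> * (L * real n ^ l) powr \<alpha> \<le> \<theta> * (L * real n ^ l) - 2" using sublinear l by blast
    moreover have "0 \<le> K / \<sigma> * (L * real n ^ l) powr \<alpha>" using assms \<sigma> by simp
    ultimately have k: "real k \<le> \<theta> * (L * real n ^ l) - 1" "\<theta> * (L * real n ^ l) - 2 < real k"
      unfolding k_def by linarith+
    have end_le: "(of_int i + real k) / real n ^ l \<le> w + \<theta> * L"
      using i k by (simp add: pos_divide_le_eq distrib_right mult.assoc)
    have "\<exists>t<k. cell l (i + int t) = 0"
    proof (rule ccontr)
      assume "\<not> (\<exists>t<k. cell l (i + int t) = 0)"
      then have "(\<Sum>t<k. \<sigma> / real N ^ l) \<le> (\<Sum>t<k. cell l (i + int t))"
        by (intro sum_mono \<sigma>(2)[OF l(1)]) auto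
      also have "\<dots> = M (of_int i / real n ^ l) ((of_int i + real k) / real n ^ l)"
        by (rule grid_sum[symmetric])
      also have "\<dots> \<le> M w (w + \<theta> * L)"
        using i end_le by (intro M_mono divide_right_mono) (auto simp: pos_le_divide_eq)
      also note small
      finally have "real k * \<sigma> \<le> K * (L powr \<alpha> * real N ^ l)" by (simp add: pos_divide_le_eq mult.assoc)
      also have "L powr \<alpha> * real N ^ l = (L * real n ^ l) powr \<alpha>"
        using L n_pow_powr[of l] by (simp add: powr_mult)
      finally have "real k \<le> K / \<sigma> * (L * real n ^ l) powr \<alpha>" using \<sigma>(1) by (simp add: field_simps)
      then show False using sub k by linarith
    qed
    then obtain t where t: "t < k" "cell l (i + int t) = 0" by blast
    define p where "p = of_int (i + int t) / real n ^ l"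
    have step: "1 / (real n * R0) * L \<le> 1 / real n ^ l"
      using l(3) n_gt_1 R0 by (simp add: field_simps)
    have cell_end: "(of_int (i + int t) + 1) / real n ^ l = p + 1 / real n ^ l"
      by (simp add: p_def add_divide_distrib)
    have "w \<le> p" using i by (simp add: p_def pos_le_divide_eq)
    moreover have "p + 1 / real n ^ l \<le> w + \<theta> * L"
    proof -
      have "(of_int (i + int t) + 1) / real n ^ l \<le> (of_int i + real k) / real n ^ l"
        using t(1) by (intro divide_right_mono) auto
      then show ?thesis using end_le cell_end by linarith
    qed
    moreover have "M p (p + 1 / (real n * R0) * L) = 0"
    proof -
      have "0 \<le> 1 / (real n * R0) * L" using L R0 by simp
      then have "M p (p + 1 / (real n * R0) * L) \<le> M p (p + 1 / real n ^ l)"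
        using step by (intro M_mono) auto
      also have "\<dots> = 0" using t(2) cell_end by (simp add: p_def)
      finally show ?thesis using M_nonneg by (metis order_antisym)
    qed
    ultimately show "\<exists>p\<ge>w. p + 1 / (real n * R0) * L \<le> w + \<theta> * L \<and> M p (p + 1 / (real n * R0) * L) = 0"
      using step by (intro exI[of _ p]) linarith
  qed
qed


text \<open>The \<open>k\<close>-th iterate of \<open>x \<mapsto> \<rho> x + c\<close> has the form \<open>x \<mapsto> \<rho>\<^sup>k x + t\<close>, and only its ratio matters.\<close>

lemma iterated_push:
  "\<exists>t. \<forall>a b. a \<le> b \<longrightarrow> (\<rho> ^ k) powr \<alpha> * M a b \<le> M (\<rho> ^ k * a + t) (\<rho> ^ k * b + t)"
proof (induction k)
  case 0
  then show ?case by (intro exI[of _ 0]) simp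
next
  case (Suc k)
  then obtain t where t: "\<And>a b. a \<le> b \<Longrightarrow> (\<rho> ^ k) powr \<alpha> * M a b \<le> M (\<rho> ^ k * a + t) (\<rho> ^ k * b + t)"
    by blast
  have "(\<rho> ^ Suc k) powr \<alpha> * M a b \<le> M (\<rho> ^ Suc k * a + (\<rho> * t + c)) (\<rho> ^ Suc k * b + (\<rho> * t + c))"
    if ab: "a \<le> b" for a b
  proof -
    have "(\<rho> ^ Suc k) powr \<alpha> * M a b = \<rho> powr \<alpha> * ((\<rho> ^ k) powr \<alpha> * M a b)"
      using \<rho>_pos by (simp add: powr_mult)
    also have "\<dots> \<le> \<rho> powr \<alpha> * M (\<rho> ^ k * a + t) (\<rho> ^ k * b + t)"
      by (intro mult_left_mono t ab) auto
    also have "\<dots> \<le> M (\<rho> * (\<rho> ^ k * a + t) + c) (\<rho> * (\<rho> ^ k * b + t) + c)"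
      using ab \<rho>_pos by (intro M_push) (simp add: mult_left_mono)
    finally show ?thesis by (simp add: distrib_left ac_simps)
  qed
  then show ?case by blast
qed

text \<open>Let \<open>r = \<rho>\<^sup>k\<close> be the ratio of the \<open>k\<close>-th iterate. The image of \<open>[u, v]\<close> has mass at most
\<open>(1 + \<epsilon>) D r\<^sup>\<alpha> (v - u)\<^sup>\<alpha>\<close>, while the scaled mass of \<open>[u, v]\<close>, which it contains, is at least
\<open>(1 - \<epsilon>) D r\<^sup>\<alpha> (v - u)\<^sup>\<alpha>\<close>. Hence the iterate multiplies the mass of every subinterval by \<open>r\<^sup>\<alpha>\<close>, up to an
excess of at most \<open>2 \<epsilon> D r\<^sup>\<alpha> (v - u)\<^sup>\<alpha>\<close>. The images of the two massless gaps are at least as long as the cells of a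
suitable level \<open>l\<close>, so each contains a point of that grid. The preimages of these two points bound an
interval of mass exactly \<open>M p q\<close>, and the mass between the points themselves is a sum of boundedly
many cell masses. The bound on their number depends on \<open>n\<close> and \<open>\<delta>\<close>, not on \<open>k\<close>, \<open>\<epsilon>\<close> or the interval.\<close>

lemma quantized_image_mass:
  assumes \<delta>: "0 < \<delta>" and \<epsilon>: "0 < \<epsilon>"
    and d: "d \<le> 1 / real n ^ l0" and uv: "v - u \<le> d"
    and upper: "\<And>a b. a < b \<Longrightarrow> b - a \<le> d \<Longrightarrow> M a b \<le> (1 + \<epsilon>) * D * (b - a) powr \<alpha>"
    and lower: "(1 - \<epsilon>) * D * (v - u) powr \<alpha> \<le> M u v"
    and gaps: "u \<le> p" "p + \<delta> * (v - u) < q" "q + \<delta> * (v - u) \<le> v"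
      "M p (p + \<delta> * (v - u)) = 0" "M q (q + \<delta> * (v - u)) = 0"
    and heavy: "D * (v - u) powr \<alpha> \<le> 2 * M p q"
    and L: "u < v"
  shows "\<exists>l xs. set xs \<subseteq> S \<and> length xs \<le> nat \<lceil>real n / \<delta> + 1\<rceil>
    \<and> (\<rho> ^ k * real n ^ l) powr \<alpha> * M p q \<le> sum_list xs
    \<and> sum_list xs \<le> (\<rho> ^ k * real n ^ l) powr \<alpha> * M p q * (1 + 4 * \<epsilon>)"
proof -
  define L where "L = v - u"
  have L0: "0 < L" using L by (simp add: L_def)
  note gaps' = gaps[folded L_def]
  define r where "r = \<rho> ^ k"
  have r: "0 < r" "r \<le> 1" using \<rho>_pos \<rho>_less by (auto simp: r_def power_le_one)
  obtain t where t: "\<And>a b. a \<le> b \<Longrightarrow> r powr \<alpha> * M a b \<le> M (r * a + t) (r * b + t)"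
    using iterated_push[of k] unfolding r_def by blast
  define g where "g = r * (\<delta> * L)"
  have g0: "0 < g" using r \<delta> L0 by (simp add: g_def)
  have \<delta>L: "\<delta> * L \<le> L" using gaps' L0 \<delta> mult_pos_pos[OF \<delta> L0] unfolding L_def by linarith
  have "g \<le> 1 * L" unfolding g_def using r \<delta>L \<delta> L0 by (intro mult_mono) auto
  then have g1: "g \<le> 1 / real n ^ l0" using uv d by (simp add: L_def)
  obtain l where l: "l0 \<le> l" "1 \<le> g * real n ^ l" "g * real n ^ l < real n * 1"
    using pick_level[OF g0 g1, of 1] by auto
  have g_ge: "1 / real n ^ l \<le> g" using l(2) by (simp add: pos_divide_le_eq)
  \<comment> \<open>The grid points \<open>a'\<close> and \<open>b'\<close> defined next lie in the images of the gaps at \<open>p\<close> and \<open>q\<close>; \<open>A\<close> and \<open>B\<close> are their preimages.\<close>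
  define i where "i = \<lceil>(r * p + t) * real n ^ l\<rceil>"
  define i' where "i' = \<lceil>(r * q + t) * real n ^ l\<rceil>"
  define m where "m = nat (i' - i)"
  have pq: "p < q" using gaps' mult_pos_pos[OF \<delta> L0] by linarith
  have "i \<le> i'" unfolding i_def i'_def using pq r by (intro ceiling_mono mult_right_mono) auto
  then have im: "of_int i' = of_int i + real m" by (simp add: m_def)
  define a' where "a' = of_int i / real n ^ l"
  define b' where "b' = of_int i' / real n ^ l"
  have grid: "z \<le> of_int \<lceil>z * real n ^ l\<rceil> / real n ^ l" "of_int \<lceil>z * real n ^ l\<rceil> / real n ^ l \<le> z + g" for z
  proof -
    show "z \<le> of_int \<lceil>z * real n ^ l\<rceil> / real n ^ l" using n_gt_1 by (subst pos_le_divide_eq) auto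
    have "of_int \<lceil>z * real n ^ l\<rceil> \<le> z * real n ^ l + 1" by linarith
    then have "of_int \<lceil>z * real n ^ l\<rceil> / real n ^ l \<le> z + 1 / real n ^ l"
      using n_gt_1 by (subst pos_divide_le_eq) (auto simp: distrib_right)
    then show "of_int \<lceil>z * real n ^ l\<rceil> / real n ^ l \<le> z + g" using g_ge by linarith
  qed
  define A where "A = (a' - t) / r"
  define B where "B = (b' - t) / r"
  have rA: "r * A + t = a'" and rB: "r * B + t = b'" using r by (auto simp: A_def B_def)
  have A: "p \<le> A" "A \<le> p + \<delta> * L"
    using grid[of "r * p + t"] r
    by (auto simp: A_def a'_def i_def g_def pos_le_divide_eq pos_divide_le_eq algebra_simps)
  have B: "q \<le> B" "B \<le> q + \<delta> * L"
    using grid[of "r * q + t"] r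
    by (auto simp: B_def b'_def i'_def g_def pos_le_divide_eq pos_divide_le_eq algebra_simps)
  have "M p A \<le> 0" using M_mono[of p p A "p + \<delta> * L"] A gaps' by simp
  moreover have "M q B \<le> 0" using M_mono[of q q B "q + \<delta> * L"] B gaps' by simp
  ultimately have MAB: "M A B = M p q"
    using M_add[of p A q] M_add[of A q B] M_nonneg[of p A] M_nonneg[of q B] A B gaps' by linarith
  have low: "r powr \<alpha> * M p q \<le> M a' b'"
    using t[of A B] MAB rA rB A B gaps' by simp
  have Aord: "u \<le> A" "A \<le> B" "B \<le> v" using A B gaps' by (auto simp: L_def)
  have "M (r * u + t) (r * v + t) = M (r * u + t) a' + (M a' b' + M b' (r * v + t))"
  proof -
    have "r * u + t \<le> a'" "a' \<le> b'" "b' \<le> r * v + t"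
      unfolding rA[symmetric] rB[symmetric] using Aord r by auto
    then show ?thesis using M_add[of "r * u + t" a' "r * v + t"] M_add[of a' b' "r * v + t"] by simp
  qed
  moreover have "r powr \<alpha> * M u A \<le> M (r * u + t) a'" using t[of u A] Aord rA by simp
  moreover have "r powr \<alpha> * M B v \<le> M b' (r * v + t)" using t[of B v] Aord rB by simp
  moreover have "M u v = M u A + (M p q + M B v)"
    using M_add[of u A v] M_add[of A B v] Aord MAB by simp
  moreover have "M (r * u + t) (r * v + t) \<le> (1 + \<epsilon>) * D * (r powr \<alpha> * L powr \<alpha>)"
  proof -
    have "r * L \<le> 1 * L" using r L0 by (intro mult_right_mono) auto
    then have "M (r * u + t) (r * v + t) \<le> (1 + \<epsilon>) * D * (r * v + t - (r * u + t)) powr \<alpha>"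
      using uv r L by (intro upper) (auto simp: L_def algebra_simps)
    also have "r * v + t - (r * u + t) = r * L" by (simp add: L_def algebra_simps)
    finally show ?thesis using r L0 by (simp add: powr_mult)
  qed
  ultimately have "M a' b' \<le> (1 + \<epsilon>) * D * (r powr \<alpha> * L powr \<alpha>) - r powr \<alpha> * (M u v - M p q)"
    by (simp add: algebra_simps)
  also have "\<dots> \<le> (1 + \<epsilon>) * D * (r powr \<alpha> * L powr \<alpha>) - r powr \<alpha> * ((1 - \<epsilon>) * D * L powr \<alpha> - M p q)"
    using lower by (intro diff_left_mono mult_left_mono diff_right_mono) (auto simp: L_def)
  also have "\<dots> = r powr \<alpha> * (M p q + 2 * \<epsilon> * (D * L powr \<alpha>))" by (simp add: algebra_simps)
  also have "\<dots> \<le> r powr \<alpha> * (M p q + 2 * \<epsilon> * (2 * M p q))"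
    using heavy \<epsilon> by (intro mult_left_mono add_left_mono) (auto simp: L_def)
  finally have up: "M a' b' \<le> r powr \<alpha> * M p q * (1 + 4 * \<epsilon>)" by (simp add: algebra_simps)
  define xs where "xs = map (\<lambda>j. real N ^ l * cell l (i + int j)) [0..<m]"
  have xs_sum: "sum_list xs = real N ^ l * M a' b'"
  proof -
    have "M a' b' = (\<Sum>j<m. cell l (i + int j))"
      unfolding a'_def b'_def im by (rule grid_sum)
    then show ?thesis
      by (simp add: xs_def interv_sum_list_conv_sum_set_nat atLeast0LessThan sum_distrib_left)
  qed
  have "set xs \<subseteq> S"
  proof -
    have "real N ^ l * cell l (i + int j) \<in> S" for j
      using M_cell[OF l(1), of "i + int j"] N_gt_1 by auto
    then show ?thesis by (auto simp: xs_def)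
  qed
  moreover have "length xs \<le> nat \<lceil>real n / \<delta> + 1\<rceil>"
  proof -
    have "real m = of_int i' - of_int i" using im by simp
    also have "\<dots> \<le> ((r * q + t) * real n ^ l + 1) - (r * p + t) * real n ^ l"
      unfolding i_def i'_def by linarith
    also have "\<dots> = r * (q - p) * real n ^ l + 1" by (simp add: algebra_simps)
    also have "\<dots> \<le> r * L * real n ^ l + 1"
    proof -
      have "q - p \<le> L" using gaps' mult_pos_pos[OF \<delta> L0] unfolding L_def by linarith
      then show ?thesis using r by (intro add_right_mono mult_right_mono mult_left_mono) auto
    qed
    also have "r * L * real n ^ l = g * real n ^ l / \<delta>" using \<delta> by (simp add: g_def)
    also have "\<dots> + 1 \<le> real n / \<delta> + 1" using l(3) \<delta> by (intro add_right_mono divide_right_mono) auto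
    finally show ?thesis by (simp add: xs_def) linarith
  qed
  moreover have "(r * real n ^ l) powr \<alpha> = real N ^ l * r powr \<alpha>"
    using r by (simp add: powr_mult n_pow_powr)
  ultimately show ?thesis
    using low up by (intro exI[of _ l] exI[of _ xs]) (auto simp: xs_sum r_def mult.assoc)
qed

text \<open>Apply the previous lemma to all iterates with one near-extremal interval. The values
\<open>(\<rho>\<^sup>k n\<^sup>l)\<^sup>\<alpha> M p q\<close> are within a factor \<open>1 + 4 \<epsilon>\<close> of elements of a finite set \<open>S'\<close> that does not depend
on \<open>\<epsilon>\<close>. Among the exponents \<open>0, \<dots>, card S'\<close> two share the same element, and dividing cancels the
unknown mass \<open>M p q\<close>: some \<open>\<rho>\<^sup>j n\<^sup>e\<close> with \<open>1 \<le> j \<le> card S'\<close> is within \<open>O(\<epsilon>)\<close> of 1.\<close>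

lemma approximate_commensurability:
  obtains P :: nat where
    "\<And>\<epsilon>. 0 < \<epsilon> \<Longrightarrow> \<epsilon> \<le> 1 / 4 \<Longrightarrow>
      \<exists>j e. 1 \<le> j \<and> j \<le> P \<and> \<bar>real j * ln \<rho> + of_int e * ln (real n)\<bar> \<le> 4 * \<epsilon> / \<alpha>"
proof -
  obtain D where D: "0 < D"
    "\<And>\<epsilon>. 0 < \<epsilon> \<Longrightarrow> \<exists>d u v. d \<le> 1 / real n ^ l0 \<and> u < v \<and> v - u \<le> d
        \<and> (\<forall>a b. a < b \<and> b - a \<le> d \<longrightarrow> M a b \<le> (1 + \<epsilon>) * D * (b - a) powr \<alpha>)
        \<and> (1 - \<epsilon>) * D * (v - u) powr \<alpha> \<le> M u v"
    using near_extremal_interval by blast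
  \<comment> \<open>With this \<open>\<theta>\<close> the two end pieces of relative length \<open>\<theta>\<close> hold at most an eighth of \<open>D L\<^sup>\<alpha>\<close>,
  so more than half of \<open>D L\<^sup>\<alpha>\<close> is carried by what lies between them.\<close>
  define \<theta> :: real where "\<theta> = (1 / 32) powr (1 / \<alpha>)"
  have \<theta>\<alpha>: "\<theta> powr \<alpha> = 1 / 32" using \<alpha>_pos by (simp add: \<theta>_def powr_powr)
  have \<theta>: "0 < \<theta>" "\<theta> \<le> 1 / 32"
    using powr_mono'[of 1 "1 / \<alpha>" "1 / 32 :: real"] \<alpha>_pos \<alpha>_less_1 by (auto simp: \<theta>_def)
  obtain \<delta> where \<delta>: "0 < \<delta>"
    "\<And>w L. \<lbrakk>0 < L; L \<le> 1 / real n ^ l0; M w (w + \<theta> * L) \<le> (2 * D) * L powr \<alpha>\<rbrakk>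
      \<Longrightarrow> \<exists>p\<ge>w. p + \<delta> * L \<le> w + \<theta> * L \<and> M p (p + \<delta> * L) = 0"
    using massless_gap[of \<theta> "2 * D"] \<theta>(1) D(1) by auto
  define S' where "S' = sum_list ` {xs. set xs \<subseteq> S \<and> length xs \<le> nat \<lceil>real n / \<delta> + 1\<rceil>}"
  have finS': "finite S'" unfolding S'_def by (intro finite_imageI finite_lists_length_le finite_S)
  show ?thesis
  proof (rule that[of "card S'"])
    fix \<epsilon> :: real assume \<epsilon>: "0 < \<epsilon>" "\<epsilon> \<le> 1 / 4"
    obtain d u v where d: "d \<le> 1 / real n ^ l0" and uv: "u < v" "v - u \<le> d"
      and upper: "\<And>a b. a < b \<Longrightarrow> b - a \<le> d \<Longrightarrow> M a b \<le> (1 + \<epsilon>) * D * (b - a) powr \<alpha>"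
      and lower: "(1 - \<epsilon>) * D * (v - u) powr \<alpha> \<le> M u v"
      using D(2)[OF \<epsilon>(1)] by blast
    define L where "L = v - u"
    have L: "0 < L" "L \<le> d" "L \<le> 1 / real n ^ l0" using uv d by (auto simp: L_def)
    have \<theta>L: "0 < \<theta> * L" "\<theta> * L \<le> L / 32" using \<theta> L by auto
    have DL: "0 < D * L powr \<alpha>" using D L by simp
    have thin: "M w (w + \<theta> * L) \<le> D * L powr \<alpha> / 16" for w
    proof -
      have "M w (w + \<theta> * L) \<le> (1 + \<epsilon>) * D * (\<theta> * L) powr \<alpha>"
        using upper[of w "w + \<theta> * L"] \<theta>L L by simp
      also have "\<dots> = (1 + \<epsilon>) * (D * L powr \<alpha>) / 32" using \<theta> L by (simp add: powr_mult \<theta>\<alpha>)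
      also have "\<dots> \<le> 2 * (D * L powr \<alpha>) / 32"
        using \<epsilon> DL by (intro divide_right_mono mult_right_mono) auto
      finally show ?thesis by simp
    qed
    then have thin': "M w (w + \<theta> * L) \<le> (2 * D) * L powr \<alpha>" for w
      using DL thin[of w] unfolding mult.assoc[of 2 D] by linarith
    obtain p where p: "u \<le> p" "p + \<delta> * L \<le> u + \<theta> * L" "M p (p + \<delta> * L) = 0"
      using \<delta>(2)[OF L(1,3) thin'[of u]] by blast
    obtain q where q: "v - \<theta> * L \<le> q" "q + \<delta> * L \<le> v" "M q (q + \<delta> * L) = 0"
      using \<delta>(2)[OF L(1,3) thin'[of "v - \<theta> * L"]] by auto
    have \<delta>L: "0 < \<delta> * L" using \<delta>(1) L(1) by simp
    have mid: "u + \<theta> * L < v - \<theta> * L" using \<theta>L L(1) L_def by linarith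
    have "M u v = M u (u + \<theta> * L) + (M (u + \<theta> * L) (v - \<theta> * L) + M (v - \<theta> * L) v)"
      using M_add[of u "u + \<theta> * L" v] M_add[of "u + \<theta> * L" "v - \<theta> * L" v] \<theta>L mid by simp
    moreover have "M (u + \<theta> * L) (v - \<theta> * L) \<le> M p q"
      using p q \<delta>L mid by (intro M_mono) auto
    moreover have "(3 / 4) * (D * L powr \<alpha>) \<le> (1 - \<epsilon>) * (D * L powr \<alpha>)"
      using \<epsilon> DL by (intro mult_right_mono) auto
    ultimately have heavy: "D * L powr \<alpha> \<le> 2 * M p q"
      using thin[of u] thin[of "v - \<theta> * L"] lower DL by (simp add: L_def mult.assoc)
    have Mpq: "0 < M p q" using heavy DL by linarith
    have "\<exists>l s. s \<in> S' \<and> (\<rho> ^ k * real n ^ l) powr \<alpha> * M p q \<le> s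
      \<and> s \<le> (\<rho> ^ k * real n ^ l) powr \<alpha> * M p q * (1 + 4 * \<epsilon>)" for k
      using quantized_image_mass[of \<delta> \<epsilon> d v u D p q k] \<delta>(1) \<epsilon>(1) d uv upper lower p q mid heavy
      unfolding S'_def L_def by fastforce
    then obtain l s where s: "\<And>k. s k \<in> S'"
      and s_low: "\<And>k. (\<rho> ^ k * real n ^ l k) powr \<alpha> * M p q \<le> s k"
      and s_up: "\<And>k. s k \<le> (\<rho> ^ k * real n ^ l k) powr \<alpha> * M p q * (1 + 4 * \<epsilon>)"
      by metis
    have "card (s ` {0..card S'}) \<le> card S'" using s finS' by (intro card_mono) auto
    then have "\<not> inj_on s {0..card S'}" by (intro pigeonhole) simp
    then obtain k k' where kk: "k < k'" "k' \<le> card S'" "s k = s k'"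
      unfolding inj_on_def by (metis atLeastAtMost_iff linorder_neqE_nat)
    define T where "T k = (\<rho> ^ k * real n ^ l k) powr \<alpha>" for k
    have T0: "0 < T k" for k using \<rho>_pos by (simp add: T_def)
    have lnT: "ln (T k) = \<alpha> * (real k * ln \<rho> + real (l k) * ln (real n))" for k
      using \<rho>_pos n_gt_1 by (simp add: T_def ln_powr ln_mult ln_realpow)
    have ln_le: "ln (T a) \<le> ln (T b) + 4 * \<epsilon>" if "s a = s b" for a b
    proof -
      have "T a * M p q \<le> T b * (1 + 4 * \<epsilon>) * M p q"
        using s_low[of a] s_up[of b] that by (simp add: T_def ac_simps)
      then have "T a \<le> T b * (1 + 4 * \<epsilon>)" using Mpq by simp
      then have "ln (T a) \<le> ln (T b * (1 + 4 * \<epsilon>))" using T0 \<epsilon> by (simp add: add_pos_pos)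
      also have "\<dots> = ln (T b) + ln (1 + 4 * \<epsilon>)" using T0[of b] \<epsilon> by (intro ln_mult_pos) auto
      also have "ln (1 + 4 * \<epsilon>) \<le> 4 * \<epsilon>" using \<epsilon> by (intro ln_add_one_self_le_self) simp
      finally show ?thesis by simp
    qed
    have "\<bar>ln (T k') - ln (T k)\<bar> \<le> 4 * \<epsilon>"
      using ln_le[OF kk(3)] ln_le[OF kk(3)[symmetric]] by linarith
    also have "ln (T k') - ln (T k)
        = \<alpha> * (real (k' - k) * ln \<rho> + of_int (int (l k') - int (l k)) * ln (real n))"
      using kk(1) by (simp add: lnT of_nat_diff algebra_simps)
    finally have "\<bar>real (k' - k) * ln \<rho> + of_int (int (l k') - int (l k)) * ln (real n)\<bar> \<le> 4 * \<epsilon> / \<alpha>"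
      using \<alpha>_pos by (simp add: abs_mult pos_le_divide_eq mult.commute)
    moreover have "1 \<le> k' - k" "k' - k \<le> card S'" using kk by auto
    ultimately show "\<exists>j e. 1 \<le> j \<and> j \<le> card S' \<and> \<bar>real j * ln \<rho> + of_int e * ln (real n)\<bar> \<le> 4 * \<epsilon> / \<alpha>"
      by blast
  qed
qed

text \<open>Only finitely many \<open>j\<close> compete. If no multiple \<open>j z\<close> of \<open>z = ln \<rho> / ln n\<close> with \<open>1 \<le> j \<le> P\<close> were an
integer, these multiples would keep a positive distance from the integers, against the approximation
for small \<open>\<epsilon>\<close>.\<close>

lemma ratio_rational_power: "\<exists>q\<in>\<rat>. \<rho> = real n powr q"
proof -
  obtain P where P: "\<And>\<epsilon>. 0 < \<epsilon> \<Longrightarrow> \<epsilon> \<le> 1 / 4 \<Longrightarrow>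
      \<exists>j e. 1 \<le> j \<and> j \<le> P \<and> \<bar>real j * ln \<rho> + of_int e * ln (real n)\<bar> \<le> 4 * \<epsilon> / \<alpha>"
    using approximate_commensurability by blast
  define z where "z = ln \<rho> / ln (real n)"
  have lnn: "0 < ln (real n)" using n_gt_1 by simp
  have "\<exists>j. 1 \<le> j \<and> j \<le> P \<and> real j * z \<in> \<int>"
  proof (rule ccontr)
    assume neg: "\<nexists>j. 1 \<le> j \<and> j \<le> P \<and> real j * z \<in> \<int>"
    define \<eta> where "\<eta> j = min (frac (real j * z)) (1 - frac (real j * z))" for j
    have \<eta>_pos: "0 < \<eta> j" if "j \<in> {1..P}" for j
      using neg that frac_lt_1[of "real j * z"] by (auto simp: \<eta>_def frac_gt_0_iff)
    have \<eta>_le: "\<eta> j \<le> \<bar>real j * z + of_int e\<bar>" for j e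
    proof -
      define f where "f = \<lfloor>real j * z\<rfloor> + e"
      have "real j * z + of_int e = frac (real j * z) + of_int f" by (simp add: frac_def f_def)
      moreover have "0 \<le> frac (real j * z)" "frac (real j * z) < 1" by (simp_all add: frac_lt_1)
      moreover have "of_int f \<ge> (0 :: real) \<or> of_int f \<le> (- 1 :: real)" by (cases "0 \<le> f") auto
      ultimately show ?thesis unfolding \<eta>_def by linarith
    qed
    define \<kappa> where "\<kappa> = Min (insert 1 (\<eta> ` {1..P}))"
    have \<kappa>: "0 < \<kappa>" "\<And>j. j \<in> {1..P} \<Longrightarrow> \<kappa> \<le> \<eta> j"
      using \<eta>_pos unfolding \<kappa>_def by (simp, intro Min_le) auto
    define \<epsilon> where "\<epsilon> = min (1 / 4) (\<kappa> * ln (real n) * \<alpha> / 8)"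
    have \<epsilon>: "0 < \<epsilon>" "\<epsilon> \<le> 1 / 4" "\<epsilon> \<le> \<kappa> * ln (real n) * \<alpha> / 8" using \<kappa>(1) lnn \<alpha>_pos by (auto simp: \<epsilon>_def)
    obtain j e where je: "1 \<le> j" "j \<le> P" "\<bar>real j * ln \<rho> + of_int e * ln (real n)\<bar> \<le> 4 * \<epsilon> / \<alpha>"
      using P[OF \<epsilon>(1,2)] by blast
    have "real j * ln \<rho> + of_int e * ln (real n) = (real j * z + of_int e) * ln (real n)"
      using lnn by (simp add: z_def distrib_right)
    then have "\<kappa> * ln (real n) \<le> \<bar>real j * ln \<rho> + of_int e * ln (real n)\<bar>"
      using lnn \<kappa>(2)[of j] \<eta>_le[of j e] je by (simp add: abs_mult mult_right_mono)
    also note je(3)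
    also have "4 * \<epsilon> / \<alpha> \<le> \<kappa> * ln (real n) / 2" using \<epsilon>(3) \<alpha>_pos by (simp add: pos_divide_le_eq)
    finally show False using \<kappa>(1) lnn by (simp add: mult_pos_pos)
  qed
  then obtain j e where j: "1 \<le> j" "real j * z = of_int e" by (auto elim: Ints_cases)
  then have "z = of_int e / of_nat j" by (simp add: field_simps)
  then have "z \<in> \<rat>" by simp
  moreover have "\<rho> = real n powr z" using lnn \<rho>_pos n_gt_1 by (simp add: powr_def z_def)
  ultimately show ?thesis by blast
qed

end

section \<open>Digit series and products\<close>

text \<open>The factors \<open>k l / N\<close> are either 1 or at most \<open>1 - 1 / N\<close>. If factors of the second kind occur
infinitely often, the bound \<open>b \<le> 1\<close> far out forces every \<open>b l\<close> to be 0; otherwise the sequence is constant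
from some index on.\<close>

lemma eventually_constant_product:
  fixes b :: "nat \<Rightarrow> real" and k :: "nat \<Rightarrow> nat"
  assumes bound: "\<And>l. 0 \<le> b l" "\<And>l. b l \<le> 1"
    and k: "\<And>l. k l \<le> N" and N: "0 < N"
    and rec: "\<And>l. b l = real (k l) / real N * b (Suc l)"
  shows "\<exists>L. \<forall>l\<ge>L. b l = b L"
proof (cases "\<exists>L. \<forall>l\<ge>L. k l = N")
  case True
  then obtain L where L: "\<And>l. L \<le> l \<Longrightarrow> k l = N" by blast
  have "b l = b L" if "L \<le> l" for l
    using that
  proof (induction rule: dec_induct)
    case (step l)
    then show ?case using rec[of l] L[of l] N by simp
  qed simp
  then show ?thesis by blast
next
  case False
  define \<theta> where "\<theta> = real (N - 1) / real N"
  have \<theta>: "0 \<le> \<theta>" "\<theta> < 1" using N by (auto simp: \<theta>_def)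
  have mono: "b l \<le> b (Suc l)" for l
    using rec[of l] k[of l] N bound(1)[of "Suc l"] mult_right_mono[of "real (k l) / real N" 1 "b (Suc l)"] by simp
  have "b l \<le> \<theta> ^ q" for l q
  proof (induction q arbitrary: l)
    case (Suc q)
    obtain l' where l': "l \<le> l'" "k l' \<noteq> N" using False by blast
    have "b l \<le> b l'" by (rule lift_Suc_mono_le[of b, OF mono l'(1)])
    also have "\<dots> = real (k l') / real N * b (Suc l')" by (rule rec)
    also have "\<dots> \<le> \<theta> * \<theta> ^ q"
    proof (rule mult_mono)
      have "k l' \<le> N - 1" using l'(2) k[of l'] by linarith
      then show "real (k l') / real N \<le> \<theta>"
        unfolding \<theta>_def by (intro divide_right_mono) auto
    qed (use Suc \<theta> bound in auto)
    finally show ?case by simp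
  qed (use bound in simp)
  then have "b l \<le> 0" for l
    using LIMSEQ_power_zero[of \<theta>] \<theta> by (intro LIMSEQ_le_const[of "\<lambda>q. \<theta> ^ q"]) auto
  then have "b l = 0" for l using bound(1)[of l] by (simp add: order_antisym)
  then show ?thesis by auto
qed

lemma digit_series:
  fixes b :: nat and d :: "nat \<Rightarrow> nat"
  assumes "2 \<le> b" "\<And>k. d k \<le> b - 1"
  defines "v \<equiv> \<lambda>d. \<Sum>k. real (d k) / real b ^ Suc k"
  shows "0 \<le> v d" and "v d \<le> 1"
    and "v d = (real (d 0) + v (\<lambda>k. d (Suc k))) / real b"
proof -
  have "(\<lambda>k. (real b - 1) / real b * (1 / real b) ^ k) sums ((real b - 1) / real b * (1 / (1 - 1 / real b)))"
    using assms(1) by (intro sums_mult geometric_sums) simp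
  also have "(real b - 1) / real b * (1 / (1 - 1 / real b)) = 1"
    using assms(1) by (simp add: field_simps)
  finally have geo: "(\<lambda>k. (real b - 1) / real b ^ Suc k) sums 1"
    by (simp add: power_one_over field_simps)
  have le: "real (d k) / real b ^ Suc k \<le> (real b - 1) / real b ^ Suc k"
    if "\<And>k. d k \<le> b - 1" for d :: "nat \<Rightarrow> nat" and k
    using that[of k] assms(1) by (intro divide_right_mono) auto
  have sm: "summable (\<lambda>k. real (d k) / real b ^ Suc k)" if "\<And>k. d k \<le> b - 1" for d :: "nat \<Rightarrow> nat"
    using le[OF that] by (intro summable_comparison_test'[OF sums_summable[OF geo], of 0]) auto
  show "0 \<le> v d" unfolding v_def by (intro suminf_nonneg sm assms(2)) auto
  show "v d \<le> 1"
    using suminf_le[OF le[OF assms(2)] sm[OF assms(2)] sums_summable[OF geo]] sums_unique[OF geo]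
    by (simp add: v_def)
  have "v d = (\<Sum>k. real (d (Suc k)) / real b ^ Suc (Suc k)) + real (d 0) / real b"
    unfolding v_def using suminf_split_head[OF sm[of d, OF assms(2)]] by simp
  also have "(\<Sum>k. real (d (Suc k)) / real b ^ Suc (Suc k)) = v (\<lambda>k. d (Suc k)) / real b"
    unfolding v_def using suminf_divide[OF sm[of "\<lambda>k. d (Suc k)"], of "real b"] assms(2)
    by (simp add: mult.commute)
  finally show "v d = (real (d 0) + v (\<lambda>k. d (Suc k))) / real b" by (simp add: add_divide_distrib)
qed

section \<open>Slices of a carpet\<close>

locale carpet =
  fixes n m :: nat and \<Lambda> :: "(nat \<times> nat) set"
  assumes m_ge_2: "2 \<le> m" and m_less_n: "m < n"
    and digits: "\<Lambda> \<subseteq> {0..n - 1} \<times> {0..m - 1}"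
begin

abbreviation K :: "(real \<times> real) set" where "K \<equiv> bm_carpet n m \<Lambda>"

lemma n_pos [simp]: "0 < n" "n \<noteq> 0" and m_pos [simp]: "0 < m" "m \<noteq> 0"
  using m_ge_2 m_less_n by auto

lemma carpetI:
  assumes "\<And>k. (i k, j k) \<in> \<Lambda>"
  shows "((\<Sum>k. real (i k) / real n ^ Suc k), (\<Sum>k. real (j k) / real m ^ Suc k)) \<in> K"
  unfolding bm_carpet_def using assms by auto

lemma carpetE:
  assumes "(x, y) \<in> K"
  obtains i j where "\<And>k. (i k, j k) \<in> \<Lambda>"
    "x = (\<Sum>k. real (i k) / real n ^ Suc k)" "y = (\<Sum>k. real (j k) / real m ^ Suc k)"
  using assms unfolding bm_carpet_def by blast

lemma digits_le:
  assumes "(i, j) \<in> \<Lambda>" shows "i \<le> n - 1" "j \<le> m - 1"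
  using digits assms by auto

lemma carpet_unit_square:
  assumes "(x, y) \<in> K" shows "0 \<le> x" "x \<le> 1" "0 \<le> y" "y \<le> 1"
proof -
  obtain i j where ij: "\<And>k. (i k, j k) \<in> \<Lambda>"
    and x: "x = (\<Sum>k. real (i k) / real n ^ Suc k)" and y: "y = (\<Sum>k. real (j k) / real m ^ Suc k)"
    by (rule carpetE[OF assms]) (rule that)
  have n2: "2 \<le> n" using m_ge_2 m_less_n by linarith
  show "0 \<le> x" "x \<le> 1" unfolding x by (rule digit_series[OF n2 digits_le(1)[OF ij]])+
  show "0 \<le> y" "y \<le> 1" unfolding y by (rule digit_series[OF m_ge_2 digits_le(2)[OF ij]])+
qed

text \<open>Digit sequences appear only in this equivalence and in the inclusion of the carpet in the unit square;
both directions amount to removing or prepending the first digit.\<close>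

lemma carpet_self_affine:
  "(x, y) \<in> K \<longleftrightarrow> (\<exists>(i, j)\<in>\<Lambda>. (real n * x - real i, real m * y - real j) \<in> K)"
proof
  have n2: "2 \<le> n" using m_ge_2 m_less_n by linarith
  {
    assume xy: "(x, y) \<in> K"
    obtain i j where ij: "\<And>k. (i k, j k) \<in> \<Lambda>"
      and x: "x = (\<Sum>k. real (i k) / real n ^ Suc k)" and y: "y = (\<Sum>k. real (j k) / real m ^ Suc k)"
      by (rule carpetE[OF xy]) (rule that)
    have "real n * x - real (i 0) = (\<Sum>k. real (i (Suc k)) / real n ^ Suc k)"
      unfolding x by (subst digit_series(3)[OF n2 digits_le(1)[OF ij]]) simp
    moreover have "real m * y - real (j 0) = (\<Sum>k. real (j (Suc k)) / real m ^ Suc k)"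
      unfolding y by (subst digit_series(3)[OF m_ge_2 digits_le(2)[OF ij]]) simp
    ultimately have "(real n * x - real (i 0), real m * y - real (j 0)) \<in> K"
      using carpetI[of "\<lambda>k. i (Suc k)" "\<lambda>k. j (Suc k)"] ij by simp
    then show "\<exists>(i, j)\<in>\<Lambda>. (real n * x - real i, real m * y - real j) \<in> K" using ij[of 0] by blast
  }
  assume "\<exists>(i, j)\<in>\<Lambda>. (real n * x - real i, real m * y - real j) \<in> K"
  then obtain i0 j0 where 0: "(i0, j0) \<in> \<Lambda>" "(real n * x - real i0, real m * y - real j0) \<in> K" by blast
  obtain i j where ij: "\<And>k. (i k, j k) \<in> \<Lambda>"
    and x: "real n * x - real i0 = (\<Sum>k. real (i k) / real n ^ Suc k)"
    and y: "real m * y - real j0 = (\<Sum>k. real (j k) / real m ^ Suc k)"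
    by (rule carpetE[OF 0(2)]) (rule that)
  have ij': "(case_nat i0 i k, case_nat j0 j k) \<in> \<Lambda>" for k using 0 ij by (cases k) auto
  have "x = (\<Sum>k. real (case_nat i0 i k) / real n ^ Suc k)"
    using x by (subst digit_series(3)[OF n2 digits_le(1)[OF ij']]) (simp add: field_simps)
  moreover have "y = (\<Sum>k. real (case_nat j0 j k) / real m ^ Suc k)"
    using y by (subst digit_series(3)[OF m_ge_2 digits_le(2)[OF ij']]) (simp add: field_simps)
  ultimately show "(x, y) \<in> K" using carpetI[OF ij'] by simp
qed

definition slices :: "real set \<Rightarrow> real set" where
  "slices Y = {x. \<exists>z\<in>Y. (x, z) \<in> K}"

lemma slices_unit: "slices Y \<subseteq> {0..1}"
  using carpet_unit_square by (auto simp: slices_def)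

text \<open>A point strictly inside the \<open>r\<close>-th column can only have \<open>r\<close> as its first digit, since all tails lie in
the unit interval.\<close>

lemma slice_in_column:
  assumes "0 < x" "x < 1"
  shows "((real r + x) / real n, z) \<in> K \<longleftrightarrow> (\<exists>j. (r, j) \<in> \<Lambda> \<and> (x, real m * z - real j) \<in> K)"
proof -
  have "((real r + x) / real n, z) \<in> K \<longleftrightarrow> (\<exists>(i, j)\<in>\<Lambda>. (real r + x - real i, real m * z - real j) \<in> K)"
    by (subst carpet_self_affine) simp
  moreover have "i = r" if "(real r + x - real i, w) \<in> K" for i w
    using carpet_unit_square(1,2)[OF that] assms by linarith
  ultimately show ?thesis by fastforce
qed

text \<open>Iterating the column identity, the slice at height \<open>y\<close> looks inside a cell of level \<open>l\<close> like a union of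
slices whose heights lie in \<open>[0, 1]\<close> and differ from \<open>m\<^sup>l y\<close> by integers. There are at most two such
heights. Working with heights instead of digit expansions of \<open>y\<close> avoids any discussion of points with
two expansions.\<close>

lemma slice_in_cell:
  assumes "0 \<le> y" "y \<le> 1"
  shows "\<exists>Y \<subseteq> {z. 0 \<le> z \<and> z \<le> 1 \<and> (\<exists>j::int. z = real m ^ l * y - of_int j)}.
    \<forall>x. 0 < x \<longrightarrow> x < 1 \<longrightarrow> ((of_int i + x) / real n ^ l, y) \<in> K \<longleftrightarrow> x \<in> slices Y"
proof (induction l arbitrary: i)
  case 0
  show ?case
  proof (cases "i = 0")
    case True
    then show ?thesis using assms by (intro exI[of _ "{y}"]) (auto simp: slices_def intro!: exI[of _ 0])
  next
    case False
    have "(of_int i + x, y) \<notin> K" if "0 < x" "x < 1" for x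
    proof
      assume "(of_int i + x, y) \<in> K"
      then have "0 \<le> of_int i + x" "of_int i + x \<le> 1" by (auto dest: carpet_unit_square)
      then show False using that False by linarith
    qed
    then show ?thesis by (intro exI[of _ "{}"]) (auto simp: slices_def)
  qed
next
  case (Suc l)
  define r where "r = nat (i mod int n)"
  have r: "int r = i mod int n" by (simp add: r_def)
  have "int r < int n" unfolding r by (rule pos_mod_bound) simp
  then have r_less: "r < n" by simp
  obtain Y where Y: "Y \<subseteq> {z. 0 \<le> z \<and> z \<le> 1 \<and> (\<exists>j::int. z = real m ^ l * y - of_int j)}"
    and Y_iff: "\<And>x. 0 < x \<Longrightarrow> x < 1 \<Longrightarrow> ((of_int (i div int n) + x) / real n ^ l, y) \<in> K \<longleftrightarrow> x \<in> slices Y"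
    using Suc[of "i div int n"] by blast
  define Y' where "Y' = {z \<in> {0..1}. \<exists>z0\<in>Y. \<exists>j. (r, j) \<in> \<Lambda> \<and> z = real m * z0 - real j}"
  have "Y' \<subseteq> {z. 0 \<le> z \<and> z \<le> 1 \<and> (\<exists>j::int. z = real m ^ Suc l * y - of_int j)}"
  proof
    fix z assume "z \<in> Y'"
    then obtain z0 j where z: "0 \<le> z" "z \<le> 1" "z0 \<in> Y" "z = real m * z0 - real j"
      by (auto simp: Y'_def)
    then obtain j0 :: int where z0: "z0 = real m ^ l * y - of_int j0" using Y by blast
    have "z = real m ^ Suc l * y - of_int (int m * j0 + int j)"
      unfolding z(4) z0 by (simp add: algebra_simps)
    then show "z \<in> {z. 0 \<le> z \<and> z \<le> 1 \<and> (\<exists>j::int. z = real m ^ Suc l * y - of_int j)}" using z by blast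
  qed
  moreover have "((of_int i + x) / real n ^ Suc l, y) \<in> K \<longleftrightarrow> x \<in> slices Y'" if x: "0 < x" "x < 1" for x
  proof -
    have "i = int n * (i div int n) + int r" using r by simp
    then have "(of_int i :: real) = real n * of_int (i div int n) + real r"
      by (metis of_int_add of_int_mult of_int_of_nat_eq)
    then have "(of_int i + x) / real n ^ Suc l = (of_int (i div int n) + (real r + x) / real n) / real n ^ l"
      by (simp add: field_simps)
    moreover have "0 < (real r + x) / real n" "(real r + x) / real n < 1" using x r_less by auto
    ultimately have "((of_int i + x) / real n ^ Suc l, y) \<in> K \<longleftrightarrow> (real r + x) / real n \<in> slices Y"
      using Y_iff by simp
    also have "\<dots> \<longleftrightarrow> (\<exists>z0\<in>Y. \<exists>j. (r, j) \<in> \<Lambda> \<and> (x, real m * z0 - real j) \<in> K)"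
      by (simp add: slices_def slice_in_column x)
    also have "\<dots> \<longleftrightarrow> x \<in> slices Y'"
      using carpet_unit_square by (fastforce simp: slices_def Y'_def)
    finally show ?thesis .
  qed
  ultimately show ?case by blast
qed

lemma cell_mass:
  assumes y: "0 \<le> y" "y \<le> 1" and N: "0 < N" and s: "0 < s" "real n powr s = real N"
  shows "\<exists>Y \<subseteq> {z. 0 \<le> z \<and> z \<le> 1 \<and> (\<exists>j::int. z = real m ^ l * y - of_int j)}.
    enn2real (hausdorff_measure s (horizontal_slice K y \<inter> {of_int i / real n ^ l..(of_int i + 1) / real n ^ l}))
      = enn2real (hausdorff_measure s (slices Y)) / real N ^ l"
proof -
  obtain Y where Y: "Y \<subseteq> {z. 0 \<le> z \<and> z \<le> 1 \<and> (\<exists>j::int. z = real m ^ l * y - of_int j)}"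
    "\<And>x. 0 < x \<Longrightarrow> x < 1 \<Longrightarrow> ((of_int i + x) / real n ^ l, y) \<in> K \<longleftrightarrow> x \<in> slices Y"
    using slice_in_cell[OF y, of l i] by blast
  have "(real n ^ l) powr s = (real n powr s) ^ l"
    by (simp add: powr_powr mult.commute flip: powr_realpow)
  then have "(1 / real n ^ l) powr s = 1 / real N ^ l" using s by (simp add: powr_divide)
  then have "hausdorff_measure s (horizontal_slice K y \<inter> {of_int i / real n ^ l..(of_int i + 1) / real n ^ l})
     = ennreal (1 / real N ^ l) * hausdorff_measure s (slices Y)"
    using hausdorff_measure_open_cell[of s "real n ^ l" "slices Y" "of_int i" "horizontal_slice K y"]
      s Y(2) slices_unit by (simp add: horizontal_slice_def)
  then show ?thesis using Y(1) by (intro exI[of _ Y]) (simp add: enn2real_mult)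
qed

text \<open>If no \<open>m\<^sup>l y\<close> is an integer, the digit of the height at each level is forced, so
\<open>T l\<close>, the slice at the fractional part of \<open>m\<^sup>l y\<close>, consists of \<open>card (D l)\<close> copies of \<open>T (l + 1)\<close>
scaled by \<open>1 / n\<close>. Their common mass is \<open>1 / N\<close> times that of \<open>T (l + 1)\<close>, and no \<open>T l\<close> has measure
above 1, so the product lemma applies.\<close>

lemma tail_mass_eventually_constant:
  assumes irr: "\<And>l. real m ^ l * y \<notin> \<int>"
    and N: "0 < N" "\<And>j. j \<le> m - 1 \<Longrightarrow> card (digit_row n \<Lambda> j) \<le> N"
    and s: "0 < s" "real n powr s = real N"
  shows "\<exists>L. \<forall>l\<ge>L. enn2real (hausdorff_measure s (slices {frac (real m ^ l * y)}))
      = enn2real (hausdorff_measure s (slices {frac (real m ^ L * y)}))"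
proof -
  define yl where "yl l = frac (real m ^ l * y)" for l
  define T where "T l = slices {yl l}" for l
  define d where "d l = nat \<lfloor>real m * yl l\<rfloor>" for l
  define D where "D l = digit_row n \<Lambda> (d l)" for l
  have yl: "0 < yl l" "yl l < 1" for l using irr[of l] by (auto simp: yl_def frac_gt_0_iff frac_lt_1)
  have d: "real (d l) \<le> real m * yl l" "real m * yl l < real (d l) + 1" "d l \<le> m - 1" for l
  proof -
    have 0: "0 \<le> real m * yl l" using yl[of l] by simp
    have "real m * yl l < real m * 1" using yl[of l] by (intro mult_strict_left_mono) auto
    moreover show "real (d l) \<le> real m * yl l" "real m * yl l < real (d l) + 1"
      unfolding d_def using 0 by linarith+
    ultimately have "real (d l) < real m" by linarith
    then show "d l \<le> m - 1" by linarith
  qed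
  have yl_Suc: "yl (Suc l) = real m * yl l - real (d l)" for l
  proof -
    have "real m ^ Suc l * y = (real m * yl l - real (d l)) + of_int (int m * \<lfloor>real m ^ l * y\<rfloor> + int (d l))"
      by (simp add: yl_def frac_def algebra_simps)
    then have "frac (real m ^ Suc l * y) = frac (real m * yl l - real (d l))"
      by (simp only: frac_add_of_int_right)
    also have "\<dots> = real m * yl l - real (d l)" using d(1,2)[of l] by (simp add: frac_eq)
    finally show ?thesis by (simp add: yl_def)
  qed
  have digit: "j = d l" if "(w, real m * yl l - real j) \<in> K" for w j l
  proof -
    have "0 \<le> real m * yl l - real j" "real m * yl l - real j \<le> 1" using carpet_unit_square[OF that] by auto
    moreover have "real m * yl l - real j \<noteq> 1"
    proof
      assume "real m * yl l - real j = 1"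
      then have "yl (Suc l) = of_int (int j + 1 - int (d l))" using yl_Suc[of l] by simp
      then show False using yl[of "Suc l"] by simp
    qed
    ultimately show ?thesis using d(1,2)[of l] by linarith
  qed
  have in_D: "r \<in> D l \<longleftrightarrow> (r, d l) \<in> \<Lambda>" for r l using digits_le(1) by (auto simp: D_def digit_row_def)
  have finD: "finite (D l)" for l by (simp add: D_def digit_row_def)
  have D_sub: "D l \<subseteq> {..<n}" for l
    using digits_le(1) in_D n_pos by (metis Suc_pred' lessThan_iff less_Suc_eq_le subsetI)
  have cardD: "card (D l) \<le> N" for l unfolding D_def by (rule N(2)[OF d(3)])
  have T_mem: "x \<in> T l \<longleftrightarrow> (x, yl l) \<in> K" for x l by (simp add: T_def slices_def)
  have T_Suc: "(r, j) \<in> \<Lambda> \<and> (x, real m * yl l - real j) \<in> K \<longleftrightarrow> j = d l \<and> r \<in> D l \<and> x \<in> T (Suc l)" for r j x l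
    unfolding T_mem in_D yl_Suc using digit[of x l j] by auto
  have T_iff: "x \<in> T l \<longleftrightarrow> (\<exists>r\<in>D l. real n * x - real r \<in> T (Suc l))" for x l
  proof -
    have "x \<in> T l \<longleftrightarrow> (\<exists>r j. (r, j) \<in> \<Lambda> \<and> (real n * x - real r, real m * yl l - real j) \<in> K)"
      unfolding T_mem by (subst carpet_self_affine) auto
    then show ?thesis unfolding T_Suc by blast
  qed
  have T_cell: "(real r + x) / real n \<in> T l \<longleftrightarrow> x \<in> (if r \<in> D l then T (Suc l) else {})" if "0 < x" "x < 1" for x r l
    using slice_in_column[OF that, of r "yl l"] unfolding T_Suc T_mem[of "(real r + x) / real n"] by simp
  have T_unit: "T l \<subseteq> {0..1}" for l unfolding T_def by (rule slices_unit)
  have rec: "hausdorff_measure s (T l) = ennreal (real (card (D l)) / real N) * hausdorff_measure s (T (Suc l))" for l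
  proof -
    have "hausdorff_measure s (T l) = hausdorff_measure s (T l \<inter> {0..real n / real n})"
      using T_unit[of l] by (simp add: Int_absorb2)
    also have "\<dots> = (\<Sum>r<n. hausdorff_measure s (T l \<inter> {real r / real n..(real r + 1) / real n}))"
      by (rule hausdorff_measure_sum_cells) (use s in auto)
    also have "\<dots> = (\<Sum>r<n. if r \<in> D l then ennreal (1 / real N) * hausdorff_measure s (T (Suc l)) else 0)"
    proof (rule sum.cong)
      fix r
      show "hausdorff_measure s (T l \<inter> {real r / real n..(real r + 1) / real n})
          = (if r \<in> D l then ennreal (1 / real N) * hausdorff_measure s (T (Suc l)) else 0)"
        using hausdorff_measure_open_cell[of s "real n" "if r \<in> D l then T (Suc l) else {}" "real r" "T l"]
          T_cell T_unit s by (simp add: powr_divide)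
    qed simp
    also have "\<dots> = (\<Sum>r\<in>{r \<in> {..<n}. r \<in> D l}. ennreal (1 / real N) * hausdorff_measure s (T (Suc l)))"
      by (rule sum.inter_filter[symmetric]) simp
    also have "{r \<in> {..<n}. r \<in> D l} = D l" using D_sub by blast
    also have "(\<Sum>r\<in>D l. ennreal (1 / real N) * hausdorff_measure s (T (Suc l)))
        = ennreal (real (card (D l)) * (1 / real N)) * hausdorff_measure s (T (Suc l))"
      by (subst ennreal_mult) (auto simp: ennreal_of_nat_eq_real_of_nat mult.assoc)
    finally show ?thesis by simp
  qed
  have le_1: "hausdorff_measure s (T l) \<le> 1" for l
  proof (rule hausdorff_measure_moran_le_1[of s "real n" T D])
    show "T l \<subseteq> (\<Union>r\<in>D l. (\<lambda>x. 1 / real n * x + real r / real n) ` T (Suc l))" for l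
    proof
      fix x assume "x \<in> T l"
      then obtain r where r: "r \<in> D l" "real n * x - real r \<in> T (Suc l)" using T_iff by blast
      then have "x = 1 / real n * (real n * x - real r) + real r / real n" by (simp add: field_simps)
      then show "x \<in> (\<Union>r\<in>D l. (\<lambda>x. 1 / real n * x + real r / real n) ` T (Suc l))" using r by blast
    qed
  qed (use s T_unit finD cardD m_ge_2 m_less_n in auto)
  have "\<exists>L. \<forall>l\<ge>L. enn2real (hausdorff_measure s (T l)) = enn2real (hausdorff_measure s (T L))"
  proof (rule eventually_constant_product)
    show "enn2real (hausdorff_measure s (T l)) \<le> 1" for l
      using enn2real_mono[OF le_1[of l]] by simp
    show "enn2real (hausdorff_measure s (T l)) = real (card (D l)) / real N * enn2real (hausdorff_measure s (T (Suc l)))" for l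
      by (subst rec) (simp add: enn2real_mult)
  qed (use cardD N in auto)
  then show ?thesis by (simp add: T_def yl_def)
qed

text \<open>The quantization of cell masses. If some \<open>m\<^sup>l y\<close> is an integer, only the heights 0 and 1 occur from then
on, with four possible sets of heights. Otherwise a cell is empty or a copy of the slice at the
fractional part of \<open>m\<^sup>l y\<close>, whose mass is eventually constant.\<close>

lemma finitely_many_cell_masses:
  assumes y: "0 \<le> y" "y \<le> 1"
    and N: "0 < N" "\<And>j. j \<le> m - 1 \<Longrightarrow> card (digit_row n \<Lambda> j) \<le> N"
    and s: "0 < s" "real n powr s = real N"
  shows "\<exists>l0 S. finite S \<and> (\<forall>l\<ge>l0. \<forall>i. \<exists>v\<in>S.
    enn2real (hausdorff_measure s (horizontal_slice K y \<inter> {of_int i / real n ^ l..(of_int i + 1) / real n ^ l}))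
      = v / real N ^ l)" (is ?thesis)
proof -
  define mass where "mass Y = enn2real (hausdorff_measure s (slices Y))" for Y
  define heights where "heights l = {z. 0 \<le> z \<and> z \<le> 1 \<and> (\<exists>j::int. z = real m ^ l * y - of_int j)}" for l
  have main: ?thesis if "finite S" "\<And>l Y. l0 \<le> l \<Longrightarrow> Y \<subseteq> heights l \<Longrightarrow> mass Y \<in> S" for S l0
  proof (intro exI[of _ l0] exI[of _ S] conjI allI impI that(1))
    fix l i assume l: "l0 \<le> l"
    show "\<exists>v\<in>S. enn2real (hausdorff_measure s (horizontal_slice K y \<inter> {of_int i / real n ^ l..(of_int i + 1) / real n ^ l})) = v / real N ^ l"
      using cell_mass[OF y N(1) s, of l i] that(2)[OF l] unfolding heights_def mass_def by blast
  qed
  show ?thesis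
  proof (cases "\<exists>l. real m ^ l * y \<in> \<int>")
    case True
    then obtain l1 where l1: "real m ^ l1 * y \<in> \<int>" by blast
    have "heights l \<subseteq> {0, 1}" if "l1 \<le> l" for l
    proof
      fix z assume "z \<in> heights l"
      then obtain j :: int where z: "0 \<le> z" "z \<le> 1" "z = real m ^ l * y - of_int j" by (auto simp: heights_def)
      have "real m ^ l = real m ^ (l - l1) * real m ^ l1"
        using that by (simp flip: power_add)
      then have "real m ^ l * y = real m ^ (l - l1) * (real m ^ l1 * y)" by (simp only: mult.assoc)
      then have "real m ^ l * y \<in> \<int>" using l1 by (metis Ints_mult Ints_power Ints_of_nat)
      then obtain e where "z = of_int e" using z(3) by (metis Ints_cases Ints_diff Ints_of_int)
      then show "z \<in> {0, 1}" using z(1,2) by (simp, linarith)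
    qed
    then show ?thesis by (intro main[of "mass ` Pow {0, 1}" l1]) blast+
  next
    case False
    then obtain L where L: "\<And>l. L \<le> l \<Longrightarrow> mass {frac (real m ^ l * y)} = mass {frac (real m ^ L * y)}"
      using tail_mass_eventually_constant[OF _ N s, of y] unfolding mass_def by blast
    have heights: "heights l \<subseteq> {frac (real m ^ l * y)}" for l
    proof
      fix z assume "z \<in> heights l"
      then obtain j :: int where z: "0 \<le> z" "z \<le> 1" "real m ^ l * y = z + of_int j" by (auto simp: heights_def)
      have "z \<noteq> 1" using False z(3) by (metis Ints_1 Ints_add Ints_of_int)
      then have "frac z = z" using z by (simp add: frac_eq)
      then show "z \<in> {frac (real m ^ l * y)}" unfolding z(3) by simp
    qed
    show ?thesis
    proof (rule main[of "{mass {}, mass {frac (real m ^ L * y)}}" L])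
      fix l Y assume "L \<le> l" "Y \<subseteq> heights l"
      then have "Y = {} \<or> Y = {frac (real m ^ l * y)}" using heights by blast
      then show "mass Y \<in> {mass {}, mass {frac (real m ^ L * y)}}" using L[OF \<open>L \<le> l\<close>] by auto
    qed simp
  qed
qed

lemma orientation_preserving_ratio:
  assumes y: "0 \<le> y" "y \<le> 1"
    and N: "2 \<le> N" "N < n" "\<And>j. j \<le> m - 1 \<Longrightarrow> card (digit_row n \<Lambda> j) \<le> N"
    and \<alpha>: "\<alpha> = ln (real N) / ln (real n)"
    and pos: "0 < hausdorff_measure \<alpha> (horizontal_slice K y)"
    and fin: "hausdorff_measure \<alpha> (horizontal_slice K y) < \<infinity>"
    and \<rho>: "0 < \<rho>" "\<rho> < 1"
    and into: "(\<lambda>x. \<rho> * x + c) ` horizontal_slice K y \<subseteq> horizontal_slice K y"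
  shows "\<exists>q\<in>\<rat>. \<rho> = real n powr q"
proof -
  define F where "F = horizontal_slice K y"
  have F_unit: "F \<subseteq> {0..1}" using carpet_unit_square by (auto simp: F_def horizontal_slice_def)
  have \<alpha>_pos: "0 < \<alpha>" and n_\<alpha>: "real n powr \<alpha> = real N" using N by (auto simp: \<alpha> powr_def)
  have N0: "0 < N" using N by simp
  obtain l0 S where S: "finite S"
    "\<And>l i. l0 \<le> l \<Longrightarrow> \<exists>v\<in>S. enn2real (hausdorff_measure \<alpha> (F \<inter> {of_int i / real n ^ l..(of_int i + 1) / real n ^ l})) = v / real N ^ l"
    using finitely_many_cell_masses[OF y N0 N(3) \<alpha>_pos n_\<alpha>] unfolding F_def by blast
  have finite_part: "hausdorff_measure \<alpha> (F \<inter> A) < top" for A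
    using hausdorff_measure_mono[of "F \<inter> A" F \<alpha>] fin by (simp add: F_def)
  interpret self_mapped_mass n N l0 "\<lambda>a b. enn2real (hausdorff_measure \<alpha> (F \<inter> {a..b}))" S \<rho> c \<alpha>
  proof
    fix a b d :: real assume abd: "a \<le> b" "b \<le> d"
    have "F \<inter> {a..d} \<inter> {..b} = F \<inter> {a..b}" "F \<inter> {a..d} \<inter> {b..} = F \<inter> {b..d}" using abd by auto
    then show "enn2real (hausdorff_measure \<alpha> (F \<inter> {a..d}))
        = enn2real (hausdorff_measure \<alpha> (F \<inter> {a..b})) + enn2real (hausdorff_measure \<alpha> (F \<inter> {b..d}))"
      using hausdorff_measure_cut[OF \<alpha>_pos, of "F \<inter> {a..d}" b] finite_part
      by (simp add: enn2real_plus)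
  next
    have "F \<inter> {0..1} = F" using F_unit by blast
    then show "\<exists>a b. a \<le> b \<and> 0 < enn2real (hausdorff_measure \<alpha> (F \<inter> {a..b}))"
      using pos fin by (intro exI[of _ 0] exI[of _ 1]) (simp add: F_def enn2real_positive_iff)
  next
    fix a b :: real
    let ?h = "\<lambda>x. \<rho> * x + c"
    have "?h ` (F \<inter> {a..b}) \<subseteq> F \<inter> {?h a..?h b}" using into \<rho> by (auto simp: F_def)
    then have "ennreal (\<rho> powr \<alpha>) * hausdorff_measure \<alpha> (F \<inter> {a..b}) \<le> hausdorff_measure \<alpha> (F \<inter> {?h a..?h b})"
      using hausdorff_measure_mono hausdorff_measure_affine[OF \<rho>(1) \<alpha>_pos] by metis
    then show "\<rho> powr \<alpha> * enn2real (hausdorff_measure \<alpha> (F \<inter> {a..b})) \<le> enn2real (hausdorff_measure \<alpha> (F \<inter> {?h a..?h b}))"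
      using enn2real_mono[OF _ finite_part] by (fastforce simp: enn2real_mult)
  qed (use N \<alpha> \<rho> S in auto)
  show ?thesis by (rule ratio_rational_power)
qed

end

theorem proposition3p3:
  fixes n m N :: nat and \<Lambda> :: "(nat \<times> nat) set" and K :: "(real \<times> real) set"
    and \<alpha> y \<rho> :: real and h :: "real \<Rightarrow> real"
  assumes "2 \<le> m" and "m < n"
    and "\<Lambda> \<subseteq> {0..n - 1} \<times> {0..m - 1}"
    and "1 < card \<Lambda>" and "card \<Lambda> < m * n"
    and "K = bm_carpet n m \<Lambda>"
    and "N = Max ((\<lambda>j. card (digit_row n \<Lambda> j)) ` {0..m - 1})"
    and "2 \<le> N" and "N \<le> n - 1"
    and "\<alpha> = ln (real N) / ln (real n)"
    and "y \<in> snd ` K"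
    and "0 < hausdorff_measure \<alpha> (horizontal_slice K y)"
    and "hausdorff_measure \<alpha> (horizontal_slice K y) < \<infinity>"
    and "contracting_similitude \<rho> h"
    and "h ` horizontal_slice K y \<subseteq> horizontal_slice K y"
  shows "\<exists>q\<in>\<rat>. \<rho> = real n powr q"
proof -
  interpret carpet n m \<Lambda> using assms by unfold_locales
  have y: "0 \<le> y" "y \<le> 1" using assms(6,11) carpet_unit_square by auto
  have N: "N < n" using assms(8,9) by linarith
  have row: "card (digit_row n \<Lambda> j) \<le> N" if "j \<le> m - 1" for j
    unfolding assms(7) using that by (intro Max_ge) auto
  note ratio = orientation_preserving_ratio[OF y assms(8) N row assms(10)
      assms(12)[unfolded assms(6)] assms(13)[unfolded assms(6)]]
  note into = assms(15)[unfolded assms(6)]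
  obtain a where \<rho>: "0 < \<rho>" "\<rho> < 1" and h: "h = (\<lambda>x. \<rho> * x + a) \<or> h = (\<lambda>x. - \<rho> * x + a)"
    using assms(14) by (auto simp: contracting_similitude_def)
  from h show ?thesis
  proof
    assume "h = (\<lambda>x. \<rho> * x + a)"
    then show ?thesis using ratio[OF _ \<rho>, of a] into by blast
  next
    assume h: "h = (\<lambda>x. - \<rho> * x + a)"
    \<comment> \<open>A reflection is replaced by its square, whose ratio is \<open>\<rho>\<^sup>2\<close>; halving the exponent keeps it rational.\<close>
    have "h (h x) = \<rho>\<^sup>2 * x + (a - \<rho> * a)" for x by (simp add: h algebra_simps power2_eq_square)
    then have "(\<lambda>x. \<rho>\<^sup>2 * x + (a - \<rho> * a)) ` horizontal_slice (bm_carpet n m \<Lambda>) y \<subseteq> horizontal_slice (bm_carpet n m \<Lambda>) y"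
      using into by (metis (no_types, lifting) image_subset_iff)
    then obtain q where q: "q \<in> \<rat>" "\<rho>\<^sup>2 = real n powr q"
      using ratio[of "\<rho>\<^sup>2" "a - \<rho> * a"] \<rho> by (auto simp: power_less_one_iff)
    have "\<rho> = (\<rho>\<^sup>2) powr (1 / 2)" using \<rho> by (simp add: powr_half_sqrt)
    also have "\<dots> = real n powr (q / 2)" unfolding q(2) by (simp add: powr_powr)
    finally show ?thesis using q(1) by (intro bexI[of _ "q / 2"]) auto
  qed
qed

end
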